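(* The edge-based districting problems $\theta_{C,I,O,W}$ and $\theta_{I,O,W}$ can be solved in polynomial time.
   Context: Edge-based districting. An instance consists of an undirected graph $G=(V,E)$, a positive integer $p \le |E|$ (districts indexed $1,\dots,p$), positive edge weights $b_e$ ($e \in E$), real bounds $\Phi_l \le \bar b \le \Phi_u$ where $\bar b = \frac{1}{p}\sum_{e\in E} b_e$, and (when centers are not selected) given center nodes $c_1,\dots,c_p \in V$, not necessarily distinct. Let $d_{u,v}$ be the shortest-path distance in $G$ with edge lengths $b_e$, and define the node-to-edge distance $d_{v,(j,k)} = \min(d_{v,j}, d_{v,k}) + \alpha\, b_{(j,k)}$ for a fixed $\alpha \in [0,1]$. Variables: $x_{i,e}$ ($i\in\{1,\dots,p\}$, $e\in E$; share of edge $e$ allocated to district $i$) and $w_{iv}$ ($w_{iv}=1$ iff $v$ is the center of district $i$). Constraint groups: (S, always present) $\sum_{i=1}^p x_{i,e}=1$ for all $e$, $\sum_{v\in V} w_{iv}=1$ for all $i$, $x_{i,e}\ge 0$, $w_{iv}\in\{0,1\}$. (B) $\Phi_l \le \sum_{e\in E} b_e x_{i,e} \le \Phi_u$ for all $i$. (C) for all $D\subseteq E$ and all $i$: $\sum_{e\in \delta(D)} x_{i,e} + \sum_{e\in D}(1-x_{i,e}) + \sum_{v\in V_D} w_{iv}\ge 1$, where $V_D$ is the set of vertices incident to an edge of $D$ and $\delta(D)$ the set of edges of $E\setminus D$ with an endpoint in $V_D$. (I) $x_{i,e}\in\{0,1\}$; if absent, $x_{i,e}\in[0,1]$ is continuous.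 (N) the $w_{iv}$ are decision variables; if absent, they are fixed by $w_{iv}=1$ iff $v=c_i$. (O) the objective is to minimize $\sum_{v\in V}\sum_{i=1}^p\sum_{e\in E} w_{iv}\, d_{v,e}\, x_{i,e}$; if absent, the objective is the constant $0$. (W) edge weights $b_e>0$ are arbitrary; if absent, $b_e=1$ for all $e$. For $X\subseteq\{B,C,I,N,O,W\}$, $\theta_X$ denotes the problem with group S and exactly the groups in $X$. Solving $\theta_X$ means outputting an optimal solution (if $O\in X$) or a feasible solution (if $O\notin X$), or reporting infeasibility. In particular, in $\theta_{C,I,O,W}$ and $\theta_{I,O,W}$ the centers $c_1,\dots,c_p$ are given and balance is not imposed. *)

theory Defs
  imports
    "HOL-Library.Log_Nat"
    "HOL-Computational_Algebra.Polynomial"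
    "Graph_Theory.Shortest_Path"
begin

section \<open>Edge-based districting\<close>

text \<open>
  Undirected edges are two-element vertex sets; districts are numbered from 1.
  The field \<open>center\<close> is only meaningful if the centers are not selected, and
  \<open>lower\<close>, \<open>upper\<close> are the balance bounds.
\<close>

record 'v districting =
  nodes :: "'v set"
  edges :: "'v set set"
  districts :: nat
  weight :: "'v set \<Rightarrow> real"
  lower :: real
  upper :: real
  center :: "nat \<Rightarrow> 'v"

datatype constraint_group =
  Balance | Contiguity | Integrality | Node_Selection | Objective | Weights

definition valid_instance :: "constraint_group set \<Rightarrow> 'v districting \<Rightarrow> bool" where
  "valid_instance X I \<longleftrightarrow>
     finite (nodes I) \<and>
     (\<forall>e\<in>edges I. e \<subseteq> nodes I \<and> card e = 2) \<and>
     1 \<le> districts I \<and> districts I \<le> card (edges I) \<and>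
     (\<forall>e\<in>edges I. 0 < weight I e) \<and>
     (Weights \<notin> X \<longrightarrow> (\<forall>e\<in>edges I. weight I e = 1)) \<and>
     lower I \<le> (\<Sum>e\<in>edges I. weight I e) / real (districts I) \<and>
     (\<Sum>e\<in>edges I. weight I e) / real (districts I) \<le> upper I \<and>
     (Node_Selection \<notin> X \<longrightarrow> (\<forall>i\<in>{1..districts I}. center I i \<in> nodes I))"

definition sym_digraph_of :: "'v districting \<Rightarrow> ('v, 'v \<times> 'v) pre_digraph" where
  "sym_digraph_of I =
     \<lparr>verts = nodes I, arcs = {(u, v). {u, v} \<in> edges I}, tail = fst, head = snd\<rparr>"

text \<open>
  Distances are extended reals: \<open>\<infinity>\<close> between different connected components. The constant
  \<open>wf_digraph.\<mu>\<close> is the infimum of the costs of all walks between two vertices.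
\<close>

definition node_dist :: "'v districting \<Rightarrow> 'v \<Rightarrow> 'v \<Rightarrow> ereal" where
  "node_dist I u v = wf_digraph.\<mu> (sym_digraph_of I) (\<lambda>(j, k). weight I {j, k}) u v"

definition edge_dist :: "real \<Rightarrow> 'v districting \<Rightarrow> 'v \<Rightarrow> 'v set \<Rightarrow> ereal" where
  "edge_dist \<alpha> I v e = Min (node_dist I v ` e) + ereal (\<alpha> * weight I e)"

definition boundary :: "'v districting \<Rightarrow> 'v set set \<Rightarrow> 'v set set" where
  "boundary I D = {e \<in> edges I - D. e \<inter> \<Union>D \<noteq> {}}"

text \<open>
  In the contiguity constraint the set \<open>D\<close> has to be nonempty: for \<open>D = {}\<close> all three sums
  vanish and the inequality would be unsatisfiable.
\<close>

definition feasible ::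
  "constraint_group set \<Rightarrow> 'v districting \<Rightarrow> (nat \<Rightarrow> 'v set \<Rightarrow> real) \<Rightarrow> (nat \<Rightarrow> 'v \<Rightarrow> real) \<Rightarrow> bool"
where
  "feasible X I x w \<longleftrightarrow>
     (\<forall>e\<in>edges I. (\<Sum>i\<in>{1..districts I}. x i e) = 1) \<and>
     (\<forall>i\<in>{1..districts I}. (\<Sum>v\<in>nodes I. w i v) = 1) \<and>
     (\<forall>i\<in>{1..districts I}. \<forall>e\<in>edges I. 0 \<le> x i e) \<and>
     (\<forall>i\<in>{1..districts I}. \<forall>v\<in>nodes I. w i v \<in> {0, 1}) \<and>
     (Balance \<in> X \<longrightarrow>
        (\<forall>i\<in>{1..districts I}.
           lower I \<le> (\<Sum>e\<in>edges I. weight I e * x i e) \<and>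
           (\<Sum>e\<in>edges I. weight I e * x i e) \<le> upper I)) \<and>
     (Contiguity \<in> X \<longrightarrow>
        (\<forall>D i. D \<subseteq> edges I \<and> D \<noteq> {} \<and> i \<in> {1..districts I} \<longrightarrow>
           (\<Sum>e\<in>boundary I D. x i e) + (\<Sum>e\<in>D. 1 - x i e) + (\<Sum>v\<in>\<Union>D. w i v) \<ge> 1)) \<and>
     (if Integrality \<in> X
      then \<forall>i\<in>{1..districts I}. \<forall>e\<in>edges I. x i e \<in> {0, 1}
      else \<forall>i\<in>{1..districts I}. \<forall>e\<in>edges I. x i e \<in> {0..1}) \<and>
     (Node_Selection \<notin> X \<longrightarrow>
        (\<forall>i\<in>{1..districts I}. \<forall>v\<in>nodes I. w i v = (if v = center I i then 1 else 0)))"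

text \<open>The products use the convention \<open>0 * \<infinity> = 0\<close> of \<open>ereal\<close>.\<close>

definition objective ::
  "constraint_group set \<Rightarrow> real \<Rightarrow> 'v districting \<Rightarrow>
   (nat \<Rightarrow> 'v set \<Rightarrow> real) \<Rightarrow> (nat \<Rightarrow> 'v \<Rightarrow> real) \<Rightarrow> ereal"
where
  "objective X \<alpha> I x w =
     (if Objective \<in> X
      then \<Sum>v\<in>nodes I. \<Sum>i\<in>{1..districts I}. \<Sum>e\<in>edges I.
             ereal (w i v) * edge_dist \<alpha> I v e * ereal (x i e)
      else 0)"

definition optimal ::
  "constraint_group set \<Rightarrow> real \<Rightarrow> 'v districting \<Rightarrow>
   (nat \<Rightarrow> 'v set \<Rightarrow> real) \<Rightarrow> (nat \<Rightarrow> 'v \<Rightarrow> real) \<Rightarrow> bool"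
where
  "optimal X \<alpha> I x w \<longleftrightarrow>
     feasible X I x w \<and>
     (\<forall>x' w'. feasible X I x' w' \<longrightarrow> objective X \<alpha> I x w \<le> objective X \<alpha> I x' w')"


section \<open>Polynomial time on a logarithmic-cost random access machine\<close>

text \<open>
  A program works on random access arrays of natural numbers; since array names are literals
  of the program text, each program uses a fixed finite number of arrays. Every evaluated
  (sub)expression is charged the bit length of its value, so that array accesses and arithmetic
  operations are charged for the lengths of their addresses, operands and results. Subtraction
  is truncated and division is integer division (with \<open>n div 0 = 0\<close>); conditions are true iff
  they are nonzero.
\<close>

datatype aexp =
    Num nat
  | Cell nat aexp
  | Plus aexp aexp
  | Minus aexp aexp
  | Times aexp aexp
  | Div aexp aexp

datatype com =
    Skip
  | Assign nat aexp aexp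
  | Seq com com
  | If aexp com com
  | While aexp com

type_synonym memory = "nat \<Rightarrow> nat \<Rightarrow> nat"

definition nat_size :: "nat \<Rightarrow> nat" where
  "nat_size n = Suc (floorlog 2 n)"

definition word_size :: "nat list \<Rightarrow> nat" where
  "word_size xs = (\<Sum>x\<leftarrow>xs. nat_size x)"

fun aval :: "aexp \<Rightarrow> memory \<Rightarrow> nat" where
  "aval (Num n) s = n"
| "aval (Cell k a) s = s k (aval a s)"
| "aval (Plus a b) s = aval a s + aval b s"
| "aval (Minus a b) s = aval a s - aval b s"
| "aval (Times a b) s = aval a s * aval b s"
| "aval (Div a b) s = aval a s div aval b s"

fun acost :: "aexp \<Rightarrow> memory \<Rightarrow> nat" where
  "acost (Num n) s = nat_size n"
| "acost (Cell k a) s = acost a s + nat_size (aval (Cell k a) s)"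
| "acost (Plus a b) s = acost a s + acost b s + nat_size (aval (Plus a b) s)"
| "acost (Minus a b) s = acost a s + acost b s + nat_size (aval (Minus a b) s)"
| "acost (Times a b) s = acost a s + acost b s + nat_size (aval (Times a b) s)"
| "acost (Div a b) s = acost a s + acost b s + nat_size (aval (Div a b) s)"

text \<open>\<open>exec c s t s'\<close>: started in \<open>s\<close>, the program \<open>c\<close> halts in \<open>s'\<close> with total cost \<open>t\<close>.\<close>

inductive exec :: "com \<Rightarrow> memory \<Rightarrow> nat \<Rightarrow> memory \<Rightarrow> bool" where
  Skip: "exec Skip s 1 s"
| Assign: "exec (Assign k a b) s (acost a s + acost b s + 1)
             (s(k := (s k)(aval a s := aval b s)))"
| Seq: "exec c1 s t1 s' \<Longrightarrow> exec c2 s' t2 s'' \<Longrightarrow> exec (Seq c1 c2) s (t1 + t2) s''"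
| IfTrue: "aval b s \<noteq> 0 \<Longrightarrow> exec c1 s t s' \<Longrightarrow> exec (If b c1 c2) s (acost b s + t + 1) s'"
| IfFalse: "aval b s = 0 \<Longrightarrow> exec c2 s t s' \<Longrightarrow> exec (If b c1 c2) s (acost b s + t + 1) s'"
| WhileTrue: "aval b s \<noteq> 0 \<Longrightarrow> exec c s t1 s' \<Longrightarrow> exec (While b c) s' t2 s'' \<Longrightarrow>
             exec (While b c) s (acost b s + t1 + t2 + 1) s''"
| WhileFalse: "aval b s = 0 \<Longrightarrow> exec (While b c) s (acost b s + 1) s"

inductive_cases exec_SkipE: "exec Skip s t s'"
inductive_cases exec_AssignE: "exec (Assign k a b) s t s'"
inductive_cases exec_SeqE: "exec (Seq c1 c2) s t s'"
inductive_cases exec_IfE: "exec (If b c1 c2) s t s'"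
inductive_cases exec_WhileE: "exec (While b c) s t s'"

lemma exec_deterministic:
  "exec c s t s' \<Longrightarrow> exec c s u s'' \<Longrightarrow> t = u \<and> s' = s''"
proof (induction arbitrary: u s'' rule: exec.induct)
  case (Skip s)
  from Skip.prems show ?case by (rule exec_SkipE) simp
next
  case (Assign k a b s)
  from Assign.prems show ?case by (rule exec_AssignE) simp
next
  case (Seq c1 s t1 s1 c2 t2 s2)
  from Seq.prems show ?case
    by (rule exec_SeqE) (metis Seq.IH)
next
  case (IfTrue b s c1 t s' c2)
  from IfTrue.prems IfTrue.hyps(1) show ?case
    by (auto elim!: exec_IfE dest: IfTrue.IH)
next
  case (IfFalse b s c2 t s' c1)
  from IfFalse.prems IfFalse.hyps(1) show ?case
    by (auto elim!: exec_IfE dest: IfFalse.IH)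
next
  case (WhileTrue b s c t1 s1 t2 s2)
  from WhileTrue.prems WhileTrue.hyps(1) obtain t1' t2' s1'
    where u: "u = acost b s + t1' + t2' + 1"
      and body: "exec c s t1' s1'" and rest: "exec (While b c) s1' t2' s''"
    by (cases rule: exec_WhileE) auto
  from WhileTrue.IH(1)[OF body] have "t1 = t1'" "s1 = s1'" by simp_all
  with WhileTrue.IH(2)[of t2' s''] rest u show ?case by simp
next
  case (WhileFalse b s c)
  from WhileFalse.prems show ?case
    by (rule exec_WhileE) (use WhileFalse.hyps in \<open>simp_all\<close>)
qed

text \<open>
  A word is stored with its length in cell 0 and its entries in the following cells. The input
  is in array 0, the output in array 1, and all other cells are initially 0. The time includes
  the size of the output.
\<close>

definition input_memory :: "nat list \<Rightarrow> memory" where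
  "input_memory xs k i = (if k = 0 \<and> i \<le> length xs then (length xs # xs) ! i else 0)"

definition output_word :: "memory \<Rightarrow> nat list" where
  "output_word s = map (\<lambda>i. s 1 (Suc i)) [0..<s 1 0]"

definition computes :: "com \<Rightarrow> nat list \<Rightarrow> nat list \<Rightarrow> nat \<Rightarrow> bool" where
  "computes c xs ys t \<longleftrightarrow>
     (\<exists>t' s. exec c (input_memory xs) t' s \<and> ys = output_word s \<and> t = t' + word_size ys)"


section \<open>Encodings and polynomial-time solvability\<close>

text \<open>
  Numerical data is rational and given by sign, numerator and denominator, not necessarily
  in lowest terms.
\<close>

definition rat_code :: "real \<Rightarrow> nat list \<Rightarrow> bool" where
  "rat_code r xs \<longleftrightarrow>
     (\<exists>s a d. xs = [s, a, d] \<and> s \<in> {0, 1} \<and> 0 < d \<and> r = (- 1) ^ s * real a / real d)"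

definition edge_code :: "nat districting \<Rightarrow> nat set \<Rightarrow> nat list \<Rightarrow> bool" where
  "edge_code I e xs \<longleftrightarrow>
     (\<exists>u v r. e = {u, v} \<and> xs = u # v # r \<and> rat_code (weight I e) r)"

text \<open>
  The vertices are \<open>0, \<dots>, n - 1\<close>. They are listed explicitly, so that the input size is at least
  the number of vertices. The list \<open>es\<close> fixes the order in which the edges are presented.
\<close>

definition instance_code ::
  "constraint_group set \<Rightarrow> nat districting \<Rightarrow> nat set list \<Rightarrow> nat list \<Rightarrow> bool"
where
  "instance_code X I es xs \<longleftrightarrow>
     (\<exists>n ds bs.
        nodes I = {..<n} \<and> distinct es \<and> set es = edges I \<and> list_all2 (edge_code I) es ds \<and>
        (if Balance \<in> X
         then \<exists>l u. rat_code (lower I) l \<and> rat_code (upper I) u \<and> bs = l @ u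
         else bs = []) \<and>
        xs = n # [0..<n] @ length es # concat ds @ districts I # bs @
             (if Node_Selection \<in> X then [] else map (center I) [1..<Suc (districts I)]))"

definition solution_code ::
  "nat districting \<Rightarrow> nat set list \<Rightarrow>
   (nat \<Rightarrow> nat set \<Rightarrow> real) \<Rightarrow> (nat \<Rightarrow> nat \<Rightarrow> real) \<Rightarrow> nat list \<Rightarrow> bool"
where
  "solution_code I es x w ys \<longleftrightarrow>
     (\<exists>qs us.
        list_all2 rat_code
          (map (\<lambda>(i, e). x i e) (List.product [1..<Suc (districts I)] es)) qs \<and>
        map real us =
          map (\<lambda>(i, v). w i v) (List.product [1..<Suc (districts I)] [0..<card (nodes I)]) \<and>
        ys = 1 # concat qs @ us)"

definition solves ::
  "constraint_group set \<Rightarrow> real \<Rightarrow> nat districting \<Rightarrow> nat set list \<Rightarrow> nat list \<Rightarrow> bool"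
where
  "solves X \<alpha> I es ys \<longleftrightarrow>
     (\<exists>x w. solution_code I es x w ys \<and> optimal X \<alpha> I x w) \<or>
     (ys = [0] \<and> (\<nexists>x w. feasible X I x w))"

text \<open>
  The distance parameter \<open>\<alpha>\<close> is a constant of the problem and not part of the input.
\<close>

definition poly_time_solvable :: "constraint_group set \<Rightarrow> real \<Rightarrow> bool" where
  "poly_time_solvable X \<alpha> \<longleftrightarrow>
     (\<exists>c (q :: nat poly). \<forall>I es xs.
        valid_instance X I \<and> instance_code X I es xs \<longrightarrow>
        (\<exists>ys t. computes c xs ys t \<and> t \<le> poly q (word_size xs) \<and> solves X \<alpha> I es ys))"

end

theory Submission
  imports Defs
begin

text \<open>
  As the centers are given and every edge goes to exactly one district, an allocation is optimal if
  every edge goes to a nearest center; the summand with \<open>\<alpha>\<close> does not matter. With ties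
  between centers broken by the smallest index, the predecessor on a shortest path belongs to the same
  district, so that this allocation is contiguous as soon as every edge can be reached from some
  center, and otherwise no contiguous allocation exists. The Bellman--Ford algorithm, run once from
  all centers on the single number \<open>index + (p + 1) * distance\<close>, computes distance and index
  together. Multiplying the rational weights by the product of all denominators makes them integers of
  polynomial bit length.
\<close>

text \<open>Adding an edge to a walk adds a multiple of \<open>p + 1\<close> to its key, so on a
  walk of least key a vertex and its predecessor have keys with the same residue; this is why both
  belong to the same district. If contiguity is imposed and some edge is reached from no center, the
  edges of its district whose ends are all unreached form a set for which all three sums of the
  contiguity constraint vanish. Without contiguity such an edge costs \<open>\<infinity>\<close> in
  every district, so any label will do.

  The obstacle on the machine side is the logarithmic cost measure: time depends on the sizes of all
  numbers computed. A single parameter \<open>X\<close> bounds both the exponent in the cell bound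
  \<open>2 ^ X\<close> and the number of iterations of each loop. The time is then a polynomial in
  \<open>X\<close> read off the program text, so that verification only has to bound stored values
  and loop counts. \<open>X\<close> is quadratic in the input size to make room for the product of
  the denominators.\<close>

section \<open>Weakest preconditions with polynomial time bounds\<close>

lemma nat_size_le: "x \<le> 2 ^ k \<Longrightarrow> nat_size x \<le> k + 2"
proof -
  assume "x \<le> 2 ^ k"
  then have "x < 2 ^ Suc k"
    by (rule le_less_trans) simp
  then show ?thesis
    unfolding nat_size_def using floorlog_leI[of x 2 "Suc k"] by simp
qed

lemma less_power_nat_size: "x < 2 ^ nat_size x"
  using floorlog_leD[of 2 x "nat_size x"] by (simp add: nat_size_def)

text \<open>Over cells of at most \<open>2 ^ X\<close>, values are at most
  \<open>2 ^ (X * d)\<close> with a degree \<open>d\<close> fixed by the syntax. A literal gets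
  degree \<open>n\<close> because \<open>n \<le> 2 ^ n\<close>, the extra 1 for sums absorbs a
  factor 2, and truncated subtraction and division cannot exceed their first argument.\<close>

fun value_degree :: "aexp \<Rightarrow> nat" where
  "value_degree (Num n) = n"
| "value_degree (Cell k a) = 1"
| "value_degree (Plus a b) = value_degree a + value_degree b + 1"
| "value_degree (Minus a b) = value_degree a"
| "value_degree (Times a b) = value_degree a + value_degree b"
| "value_degree (Div a b) = value_degree a"

definition bounded_memory :: "nat \<Rightarrow> memory \<Rightarrow> bool" where
  "bounded_memory X s \<longleftrightarrow> (\<forall>k i. s k i \<le> 2 ^ X)"

lemma aval_le:
  assumes "bounded_memory X s" "1 \<le> X"
  shows "aval a s \<le> 2 ^ (X * value_degree a)"
proof (induction a)
  case (Num n)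
  have "n \<le> 2 ^ n"
    by (simp add: less_imp_le)
  also have "\<dots> \<le> 2 ^ (X * n)"
    using assms(2) by (intro power_increasing) auto
  finally show ?case by simp
next
  case (Cell k a)
  show ?case using assms(1) by (simp add: bounded_memory_def)
next
  case (Plus a b)
  let ?x = "2 ^ (X * value_degree a) :: nat" and ?y = "2 ^ (X * value_degree b) :: nat"
  have "?x \<le> ?x * ?y" "?y \<le> ?x * ?y"
    by simp_all
  then have "?x + ?y \<le> 2 * (?x * ?y)"
    by linarith
  also have "\<dots> \<le> 2 ^ X * (?x * ?y)"
    using assms(2) by (intro mult_right_mono self_le_power) auto
  finally show ?case
    using Plus by (simp add: power_add distrib_left mult_ac)
next
  case (Minus a b)
  then show ?case by simp
next
  case (Times a b)
  then show ?case by (simp add: power_add distrib_left mult_le_mono)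
next
  case (Div a b)
  then show ?case by (simp add: order_trans[OF div_le_dividend])
qed

text \<open>The constant 2 at each node: \<open>2 ^ k\<close> has one digit more than its exponent,
  and \<open>nat_size\<close> adds one unit to every number.\<close>

fun cost_poly :: "aexp \<Rightarrow> nat poly" where
  "cost_poly (Num n) = [:2, n:]"
| "cost_poly (Cell k a) = cost_poly a + [:2, 1:]"
| "cost_poly (Plus a b) = cost_poly a + cost_poly b + [:2, value_degree (Plus a b):]"
| "cost_poly (Minus a b) = cost_poly a + cost_poly b + [:2, value_degree (Minus a b):]"
| "cost_poly (Times a b) = cost_poly a + cost_poly b + [:2, value_degree (Times a b):]"
| "cost_poly (Div a b) = cost_poly a + cost_poly b + [:2, value_degree (Div a b):]"

lemma acost_le:
  assumes "bounded_memory X s" "1 \<le> X"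
  shows "acost a s \<le> poly (cost_poly a) X"
proof -
  have size: "nat_size (aval a s) \<le> 2 + X * value_degree a" for a
    using nat_size_le[OF aval_le[OF assms]] by (simp add: add.commute)
  show ?thesis
  proof (induction a)
    case (Num n)
    show ?case using size[of "Num n"] by simp
  next
    case (Cell k a)
    then show ?case using size[of "Cell k a"] by (simp add: add_mono)
  next
    case (Plus a b)
    then show ?case using size[of "Plus a b"] by (simp add: add_mono)
  next
    case (Minus a b)
    then show ?case using size[of "Minus a b"] by (simp add: add_mono)
  next
    case (Times a b)
    then show ?case using size[of "Times a b"] by (simp add: add_mono)
  next
    case (Div a b)
    then show ?case using size[of "Div a b"] by (simp add: add_mono)
  qed
qed

section \<open>Time bounds and rules for commands\<close>

text \<open>A loop is charged for \<open>X\<close> iterations.\<close>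

fun time_poly :: "com \<Rightarrow> nat poly" where
  "time_poly Skip = 1"
| "time_poly (Assign k a b) = cost_poly a + cost_poly b + 1"
| "time_poly (Seq c1 c2) = time_poly c1 + time_poly c2"
| "time_poly (If b c1 c2) = cost_poly b + time_poly c1 + time_poly c2 + 1"
| "time_poly (While b c) = (cost_poly b + 1) + [:0, 1:] * (cost_poly b + time_poly c + 1)"

text \<open>Total correctness together with the time bound. Having the cell bound both as a premise
  and in the conclusion passes it along a program without mentioning it in the invariants.\<close>

definition wp :: "nat \<Rightarrow> com \<Rightarrow> (memory \<Rightarrow> bool) \<Rightarrow> memory \<Rightarrow> bool" where
  "wp X c Q s \<longleftrightarrow> 1 \<le> X \<and> bounded_memory X s \<longrightarrow>
     (\<exists>t s'. exec c s t s' \<and> t \<le> poly (time_poly c) X \<and> bounded_memory X s' \<and> Q s')"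

text \<open>Only a stored value needs the bound \<open>2 ^ X\<close>. Addresses and intermediate
  results may be larger; their cost is covered by \<open>acost_le\<close>.\<close>

lemma wp_Assign:
  assumes "aval b s \<le> 2 ^ X" "Q (s(k := (s k)(aval a s := aval b s)))"
  shows "wp X (Assign k a b) Q s"
  unfolding wp_def
proof (intro impI exI conjI)
  assume s: "1 \<le> X \<and> bounded_memory X s"
  show "exec (Assign k a b) s (acost a s + acost b s + 1) (s(k := (s k)(aval a s := aval b s)))"
    by (rule exec.Assign)
  show "acost a s + acost b s + 1 \<le> poly (time_poly (Assign k a b)) X"
    using s by (simp add: acost_le add_mono)
  show "bounded_memory X (s(k := (s k)(aval a s := aval b s)))"
    using s assms(1) by (simp add: bounded_memory_def)
qed (rule assms(2))

lemma wp_Seq: "wp X c1 (wp X c2 Q) s \<Longrightarrow> wp X (Seq c1 c2) Q s"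
  unfolding wp_def by simp (meson add_mono exec.Seq)

text \<open>Both branches are charged, since the maximum of two polynomials need not be a
  polynomial.\<close>

lemma wp_If:
  assumes "aval b s \<noteq> 0 \<Longrightarrow> wp X c1 Q s" "aval b s = 0 \<Longrightarrow> wp X c2 Q s"
  shows "wp X (If b c1 c2) Q s"
  unfolding wp_def
proof
  assume s: "1 \<le> X \<and> bounded_memory X s"
  then have "acost b s \<le> poly (cost_poly b) X"
    by (simp add: acost_le)
  with s assms show "\<exists>t s'. exec (If b c1 c2) s t s' \<and> t \<le> poly (time_poly (If b c1 c2)) X \<and>
      bounded_memory X s' \<and> Q s'"
    unfolding wp_def by (cases "aval b s = 0") (fastforce intro: exec.IfTrue exec.IfFalse)+
qed

lemma wp_mono: "wp X c Q s \<Longrightarrow> (\<And>s. Q s \<Longrightarrow> R s) \<Longrightarrow> wp X c R s"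
  unfolding wp_def by blast

text \<open>The invariant is indexed by the completed iterations and their number \<open>n\<close>
  is fixed in advance, so termination needs no separate measure.\<close>

lemma wp_While:
  assumes "n \<le> X" "I 0 s"
    and "\<And>s. I n s \<Longrightarrow> aval b s = 0 \<and> Q s"
    and "\<And>k s. k < n \<Longrightarrow> I k s \<Longrightarrow> aval b s \<noteq> 0 \<and> wp X c (I (Suc k)) s"
  shows "wp X (While b c) Q s"
proof -
  let ?step = "\<lambda>X. poly (cost_poly b + time_poly c + 1) X"
  have "\<exists>t s'. exec (While b c) s t s' \<and> t \<le> (poly (cost_poly b) X + 1) + (n - k) * ?step X \<and>
      bounded_memory X s' \<and> Q s'"
    if "k \<le> n" "I k s" "1 \<le> X" "bounded_memory X s" for k s
    using that
  proof (induction "n - k" arbitrary: k s)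
    case 0
    then have "k = n" by simp
    with 0 have "aval b s = 0" "Q s"
      using assms(3) by auto
    moreover from this have "exec (While b c) s (acost b s + 1) s"
      by (intro exec.WhileFalse)
    moreover have "acost b s + 1 \<le> (poly (cost_poly b) X + 1) + (n - k) * ?step X"
      using acost_le 0 by (simp add: trans_le_add1)
    ultimately show ?case using 0 by blast
  next
    case (Suc d)
    then have "k < n" by simp
    with Suc assms(4) obtain t1 s1 where 1: "aval b s \<noteq> 0" "exec c s t1 s1"
      "t1 \<le> poly (time_poly c) X" "bounded_memory X s1" "I (Suc k) s1"
      unfolding wp_def by blast
    moreover obtain t2 s2 where 2: "exec (While b c) s1 t2 s2"
      "t2 \<le> (poly (cost_poly b) X + 1) + (n - Suc k) * ?step X" "bounded_memory X s2" "Q s2"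
      using Suc 1 by (metis Suc_leI \<open>k < n\<close> diff_Suc_eq_diff_pred diff_Suc_1 diff_commute)
    ultimately have "exec (While b c) s (acost b s + t1 + t2 + 1) s2"
      by (intro exec.WhileTrue)
    moreover have "n - k = Suc (n - Suc k)"
      using \<open>k < n\<close> by simp
    then have "acost b s + t1 + t2 + 1 \<le> (poly (cost_poly b) X + 1) + (n - k) * ?step X"
      using acost_le[OF Suc(6,5), of b] 1(3) 2(2) by simp
    ultimately show ?case using 2 by blast
  qed
  \<comment> \<open>The exact count is replaced by \<open>X\<close>, because
    \<open>time_poly\<close> depends on the program text alone.\<close>
  moreover have "(n - 0) * ?step X \<le> X * ?step X"
    using mult_le_mono1[OF assms(1)] by (simp only: diff_zero)
  ultimately show ?thesis
    using assms(2) unfolding wp_def by (fastforce intro: order_trans add_left_mono)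
qed

section \<open>Counting loops and output\<close>

definition For :: "nat \<Rightarrow> aexp \<Rightarrow> com \<Rightarrow> com" where
  "For x b c = Seq (Assign x (Num 0) (Num 0))
     (While (Minus b (Cell x (Num 0))) (Seq c (Assign x (Num 0) (Plus (Cell x (Num 0)) (Num 1)))))"

text \<open>The truncated difference in the test is nonzero iff the counter is below the bound. The
  bound is reevaluated in every test, so the invariant has to fix its value; it must also be
  insensitive to the counter, which is updated outside the body \<open>c\<close>.\<close>

lemma wp_For:
  assumes "n \<le> X"
    and bound: "\<And>k s. I k s \<Longrightarrow> aval b s = n"
    and index: "\<And>k s v. I k s \<Longrightarrow> I k (s(x := (s x)(0 := v)))"
    and init: "I 0 s"
    and step: "\<And>k s. k < n \<Longrightarrow> I k s \<Longrightarrow> s x 0 = k \<Longrightarrow> wp X c (\<lambda>s'. s' x 0 = k \<and> I (Suc k) s') s"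
    and final: "\<And>s. I n s \<Longrightarrow> Q s"
  shows "wp X (For x b c) Q s"
proof -
  have "n \<le> 2 ^ X"
    using assms(1) less_exp[of X] by linarith
  have body: "wp X (Seq c (Assign x (Num 0) (Plus (Cell x (Num 0)) (Num 1))))
      (\<lambda>s'. s' x 0 = Suc k \<and> I (Suc k) s') s" if "k < n" "s x 0 = k" "I k s" for k s
    by (rule wp_Seq, rule wp_mono[OF step[OF that(1,3,2)]], rule wp_Assign)
      (use that \<open>n \<le> 2 ^ X\<close> index in auto)
  show ?thesis
    unfolding For_def
    by (rule wp_Seq, rule wp_Assign, simp,
        rule wp_While[where n = n and I = "\<lambda>k s. s x 0 = k \<and> I k s"])
      (use assms(1) bound index init final body in auto)
qed

definition Emit :: "aexp \<Rightarrow> com" where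
  "Emit a = Seq (Assign 1 (Plus (Cell 1 (Num 0)) (Num 1)) a)
     (Assign 1 (Num 0) (Plus (Cell 1 (Num 0)) (Num 1)))"

definition emit :: "nat \<Rightarrow> memory \<Rightarrow> memory" where
  "emit v s = s(1 := (s 1)(Suc (s 1 0) := v, 0 := Suc (s 1 0)))"

lemma emit_other [simp]: "k \<noteq> 1 \<Longrightarrow> emit v s k = s k"
  by (simp add: emit_def)

lemma emit_length [simp]: "emit v s (Suc 0) 0 = Suc (s 1 0)"
  by (simp add: emit_def)

lemma output_word_emit [simp]: "output_word (emit v s) = output_word s @ [v]"
  by (auto simp: output_word_def emit_def)

lemma length_output_word [simp]: "length (output_word s) = s 1 0"
  by (simp add: output_word_def)

text \<open>Strictness leaves room for the incremented length, which is stored as well.\<close>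

lemma wp_Emit:
  assumes "aval a s \<le> 2 ^ X" "length (output_word s) < 2 ^ X" "Q (emit (aval a s) s)"
  shows "wp X (Emit a) Q s"
  unfolding Emit_def
  by (intro wp_Seq wp_Assign) (use assms in \<open>auto simp: emit_def\<close>)

section \<open>Nearest sources\<close>

text \<open>Edges are numbered and have integer lengths, as the program sees them; the link to
  instances with real weights is made only in \<open>districting_voronoi\<close>.\<close>

locale voronoi =
  fixes n m p :: nat and a b \<omega> :: "nat \<Rightarrow> nat" and c :: "nat \<Rightarrow> nat"
  assumes source_less: "i \<in> {1..p} \<Longrightarrow> c i < n"
    and end_less: "j < m \<Longrightarrow> a j < n" "j < m \<Longrightarrow> b j < n"
    and length_pos: "j < m \<Longrightarrow> 0 < \<omega> j"
    and sources: "1 \<le> p"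
begin

inductive walk_length :: "nat \<Rightarrow> nat \<Rightarrow> nat \<Rightarrow> bool" for s where
  start: "walk_length s s 0"
| step: "walk_length s u k \<Longrightarrow> j < m \<Longrightarrow> {u, v} = {a j, b j} \<Longrightarrow> walk_length s v (k + \<omega> j)"

text \<open>
  Minimizing the key minimizes the distance from the nearest source and breaks ties by the index
  of the source, which can be read off the key modulo \<open>Suc p\<close>.
\<close>

definition key :: "nat \<Rightarrow> nat \<Rightarrow> bool" where
  "key v k \<longleftrightarrow> (\<exists>i\<in>{1..p}. \<exists>l. walk_length (c i) v l \<and> k = i + Suc p * l)"

definition min_key :: "nat \<Rightarrow> nat" where
  "min_key v = (LEAST k. key v k)"

definition reached :: "nat \<Rightarrow> bool" where
  "reached v \<longleftrightarrow> (\<exists>k. key v k)"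

text \<open>Takes the place of the number of edges on a shortest walk: it strictly increases from
  predecessor to vertex and is below \<open>n\<close> for reached vertices, so it both bounds the
  keys and tells in which round a vertex is settled.\<close>

definition rank :: "nat \<Rightarrow> nat" where
  "rank v = card {u. u < n \<and> reached u \<and> min_key u < min_key v}"

text \<open>
  The number \<open>big\<close> exceeds all minimal keys. As it is congruent to 1 modulo \<open>Suc p\<close>, an
  unreached edge, which has height 0, gets the label 1. Storing keys as heights, that is, complemented,
  makes truncated subtraction do the right thing for unreached vertices.
\<close>

definition big :: nat where
  "big = 1 + Suc p * (1 + n * (\<Sum>j<m. \<omega> j))"

definition height :: "nat \<Rightarrow> nat" where
  "height v = (if reached v then big - min_key v else 0)"

lemma walk_length_less:
  assumes "walk_length s v l" "s < n"
  shows "v < n"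
  using assms by (induction rule: walk_length.induct) (auto simp: doubleton_eq_iff end_less)

lemma key_source: "i \<in> {1..p} \<Longrightarrow> key (c i) i"
  unfolding key_def by (auto intro!: bexI[of _ i] exI[of _ 0] start)

lemma key_step: "key u k \<Longrightarrow> j < m \<Longrightarrow> {u, v} = {a j, b j} \<Longrightarrow> key v (k + Suc p * \<omega> j)"
  unfolding key_def using step[of _ u _ j v] by (metis (no_types, lifting) add.assoc distrib_left)

lemma key_cases:
  assumes "key v k"
  obtains (source) i where "i \<in> {1..p}" "v = c i" "k = i"
  | (edge) u j l where "key u l" "j < m" "{u, v} = {a j, b j}" "k = l + Suc p * \<omega> j"
proof -
  from assms obtain i l where il: "i \<in> {1..p}" "walk_length (c i) v l" "k = i + Suc p * l"
    unfolding key_def by blast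
  from il(2) show thesis
  proof cases
    case start
    with il show ?thesis by (intro source) auto
  next
    case (step u l' j)
    have "key u (i + Suc p * l')"
      using il(1) step(2) unfolding key_def by blast
    then show ?thesis
      using step il(3) by (intro edge) (auto simp: algebra_simps)
  qed
qed

lemma key_less: "key v k \<Longrightarrow> v < n"
  unfolding key_def using walk_length_less source_less by blast

lemma key_min_key: "reached v \<Longrightarrow> key v (min_key v)"
  unfolding reached_def min_key_def by (auto intro: LeastI)

lemma min_key_le: "key v k \<Longrightarrow> min_key v \<le> k"
  unfolding min_key_def by (rule Least_le)

lemma reachedI: "key v k \<Longrightarrow> reached v"
  unfolding reached_def by blast

text \<open>Bellman's equation: if the predecessor's key on a walk of least key were not minimal
  itself, \<open>key_step\<close> would produce a smaller key for \<open>v\<close>.\<close>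

lemma min_key_cases:
  assumes "reached v"
  obtains (source) i where "i \<in> {1..p}" "v = c i" "min_key v = i"
  | (edge) u j where "reached u" "j < m" "{u, v} = {a j, b j}"
      "min_key v = min_key u + Suc p * \<omega> j"
  using key_min_key[OF assms]
proof (cases rule: key_cases)
  case (source i)
  then show ?thesis using that(1) by blast
next
  case (edge u j l)
  have "reached u"
    using edge(1) by (rule reachedI)
  then have "min_key v \<le> min_key u + Suc p * \<omega> j"
    using key_step key_min_key edge(2,3) min_key_le by blast
  moreover have "min_key u \<le> l"
    using edge(1) by (rule min_key_le)
  ultimately show ?thesis
    using that(2)[of u j] edge \<open>reached u\<close> by simp
qed

lemma rank_mono:
  assumes "reached u" "min_key u < min_key v"
  shows "rank u < rank v"
  unfolding rank_def
proof (rule psubset_card_mono)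
  show "{w. w < n \<and> reached w \<and> min_key w < min_key u} \<subset>
      {w. w < n \<and> reached w \<and> min_key w < min_key v}"
    using assms key_less[OF key_min_key[OF assms(1)]] by auto
qed simp

lemma rank_less:
  assumes "reached v"
  shows "rank v < n"
proof -
  have "rank v < card {..<n}"
    unfolding rank_def
    by (rule psubset_card_mono) (use key_less[OF key_min_key[OF assms]] in auto)
  then show ?thesis by simp
qed

text \<open>Following predecessors, each step lowers the rank by at least 1 and the key by
  \<open>Suc p\<close> times a single length, which is at most the sum of all lengths. At the source
  only its index remains.\<close>

lemma min_key_bound: "reached v \<Longrightarrow> min_key v \<le> p + Suc p * (rank v * (\<Sum>j<m. \<omega> j))"
proof (induction "rank v" arbitrary: v rule: less_induct)
  case less
  from less(2) show ?case
  proof (cases rule: min_key_cases)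
    case (source i)
    then show ?thesis by simp
  next
    case (edge u j)
    have "rank u < rank v"
      using edge length_pos[of j] by (intro rank_mono) auto
    have "\<omega> j \<le> (\<Sum>j<m. \<omega> j)"
      using edge(2) by (intro member_le_sum) auto
    then have "rank u * (\<Sum>j<m. \<omega> j) + \<omega> j \<le> Suc (rank u) * (\<Sum>j<m. \<omega> j)"
      by simp
    also have "\<dots> \<le> rank v * (\<Sum>j<m. \<omega> j)"
      using \<open>rank u < rank v\<close> by (intro mult_le_mono1) simp
    finally have "Suc p * (rank u * (\<Sum>j<m. \<omega> j) + \<omega> j) \<le> Suc p * (rank v * (\<Sum>j<m. \<omega> j))"
      by (rule mult_le_mono2)
    then show ?thesis
      using less(1)[OF \<open>rank u < rank v\<close> edge(1)] edge(4)
      by (simp only: distrib_left)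
  qed
qed

lemma min_key_less_big: "reached v \<Longrightarrow> min_key v < big"
proof -
  assume v: "reached v"
  have "min_key v \<le> p + Suc p * (rank v * (\<Sum>j<m. \<omega> j))"
    using v by (rule min_key_bound)
  also have "\<dots> \<le> p + Suc p * (n * (\<Sum>j<m. \<omega> j))"
    using rank_less[OF v] by (intro add_left_mono mult_le_mono2 mult_le_mono1) simp
  also have "\<dots> < big"
    by (simp add: big_def)
  finally show ?thesis .
qed

lemma height_pos_iff: "0 < height v \<longleftrightarrow> reached v"
  using min_key_less_big by (simp add: height_def)

lemma height_le_big: "height v \<le> big"
  by (simp add: height_def)

lemma height_reached: "reached v \<Longrightarrow> big - height v = min_key v"
  using min_key_less_big[of v] by (simp add: height_def)

lemma height_source: "i \<in> {1..p} \<Longrightarrow> big - i \<le> height (c i)"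
  using min_key_le[OF key_source] reachedI[OF key_source] by (simp add: height_def diff_le_mono2)

lemma height_step:
  assumes "j < m" "{u, v} = {a j, b j}"
  shows "height u - Suc p * \<omega> j \<le> height v"
proof (cases "reached u")
  case True
  then have "key v (min_key u + Suc p * \<omega> j)"
    using key_step key_min_key assms by blast
  then show ?thesis
    using True min_key_le[of v "min_key u + Suc p * \<omega> j"] reachedI by (simp add: height_def)
qed (simp add: height_def)

section \<open>Invariant of the Bellman-Ford algorithm\<close>

definition relax :: "nat \<Rightarrow> nat \<Rightarrow> nat \<Rightarrow> (nat \<Rightarrow> nat) \<Rightarrow> nat \<Rightarrow> nat" where
  "relax j u v h = h(v := max (h v) (h u - Suc p * \<omega> j))"

text \<open>
  In round \<open>r\<close> of the Bellman--Ford algorithm, all vertices of rank below \<open>r\<close> are settled;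
  \<open>j\<close> edges have been processed in the current round.
\<close>

definition settled :: "nat \<Rightarrow> nat \<Rightarrow> (nat \<Rightarrow> nat) \<Rightarrow> bool" where
  "settled r j h \<longleftrightarrow>
     (\<forall>v. h v \<le> height v) \<and>
     (\<forall>i\<in>{1..p}. big - i \<le> h (c i)) \<and>
     (\<forall>v. rank v < r \<longrightarrow> h v = height v) \<and>
     (\<forall>j'<j. \<forall>u v. {u, v} = {a j', b j'} \<and> rank u < r \<longrightarrow> height u - Suc p * \<omega> j' \<le> h v)"

text \<open>Entries lie between their old and their final value, so exact entries stay exact and
  lower bounds survive. Later updates therefore cannot spoil earlier progress.\<close>

lemma settled_mono:
  assumes "settled r j h" "\<And>v. h v \<le> h' v" "\<And>v. h' v \<le> height v"
  shows "settled r j h'"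
proof -
  have "h' v = height v" if "h v = height v" for v
    using assms(2,3)[of v] that by simp
  moreover have "x \<le> h' v" if "x \<le> h v" for x v
    using assms(2)[of v] that by (rule order_trans[rotated])
  ultimately show ?thesis
    using assms(1,3) unfolding settled_def by auto
qed

lemma relax_le_height:
  assumes "\<And>v. h v \<le> height v" "j < m" "{u, v} = {a j, b j}"
  shows "relax j u v h w \<le> height w"
proof -
  have "h u - Suc p * \<omega> j \<le> height v"
    using height_step[OF assms(2,3)] assms(1)[of u] by simp
  then show ?thesis
    using assms(1) by (simp add: relax_def del: mult_Suc)
qed

lemma relax_ge: "h w \<le> relax j u v h w"
  by (simp add: relax_def del: mult_Suc)

lemma settled_relax:
  assumes "settled r j h" "j < m"
  shows "settled r (Suc j) (relax j (b j) (a j) (relax j (a j) (b j) h))" (is "settled _ _ ?h2")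
proof -
  let ?h1 = "relax j (a j) (b j) h"
  have h: "h v \<le> height v" for v
    using assms(1) by (simp add: settled_def)
  have exact: "h v = height v" if "rank v < r" for v
    using assms(1) that by (simp add: settled_def)
  have h1: "?h1 v \<le> height v" for v
    using h assms(2) by (rule relax_le_height) simp
  have h2: "?h2 v \<le> height v" for v
    using h1 assms(2) by (rule relax_le_height) auto
  have "settled r j ?h1"
    using assms(1) relax_ge h1 by (rule settled_mono)
  then have "settled r j ?h2"
    using relax_ge h2 by (rule settled_mono)
  moreover have "height u - Suc p * \<omega> j \<le> ?h2 v" if "{u, v} = {a j, b j}" "rank u < r" for u v
  \<comment> \<open>For \<open>u = a j\<close> the first update does the work and the second
    preserves it. In the other orientation the second update reads a possibly raised entry, which
    only helps.\<close>
  proof (cases "u = a j")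
    case True
    then have "h u = height u" "v = b j"
      using that(1) exact[OF that(2)] by (auto simp: doubleton_eq_iff)
    then have "height u - Suc p * \<omega> j \<le> ?h1 v"
      using True by (simp add: relax_def del: mult_Suc)
    then show ?thesis
      by (rule le_trans[OF _ relax_ge])
  next
    case False
    then have "u = b j" "v = a j"
      using that(1) by (auto simp: doubleton_eq_iff)
    moreover have "h u \<le> ?h1 u" "h u = height u"
      using relax_ge[of h u] exact[OF that(2)] by simp_all
    moreover have "?h1 u - Suc p * \<omega> j \<le> ?h2 v" if "u = b j" "v = a j"
      using that by (simp add: relax_def[of _ "b j" "a j"] del: mult_Suc)
    ultimately show ?thesis
      using diff_le_mono le_trans by metis
  qed
  ultimately show ?thesis
    unfolding settled_def less_Suc_eq by (metis (no_types, lifting))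
qed

text \<open>The predecessor of a vertex of rank \<open>r\<close> has rank below \<open>r\<close>, so
  its entry was already exact when their common edge was relaxed in this round.\<close>

lemma settled_Suc:
  assumes "settled r m h"
  shows "settled (Suc r) 0 h"
proof -
  have le: "h v \<le> height v" for v
    using assms by (simp add: settled_def)
  have relaxed: "height u - Suc p * \<omega> j \<le> h v" if "j < m" "{u, v} = {a j, b j}" "rank u < r" for u v j
    using assms that unfolding settled_def by blast
  have "h v = height v" if "rank v < Suc r" for v
  proof (cases "reached v")
    case False
    then show ?thesis
      using le[of v] by (simp add: height_def)
  next
    case True
    then have "height v \<le> h v"
    proof (cases rule: min_key_cases)
      case (source i)
      then show ?thesis
        using assms True by (auto simp: settled_def height_def)
    next
      case (edge u j)
      then have "rank u < rank v"
        using length_pos[of j] by (intro rank_mono) auto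
      then have "height u - Suc p * \<omega> j \<le> h v"
        using edge that by (intro relaxed) auto
      then show ?thesis
        using edge True by (simp add: height_def)
    qed
    with le show ?thesis
      by (rule antisym)
  qed
  then show ?thesis
    using assms by (simp add: settled_def)
qed

lemma settled_final:
  assumes "settled n 0 h"
  shows "h = height"
proof
  fix v show "h v = height v"
  proof (cases "reached v")
    case True
    then show ?thesis
      using assms rank_less[of v] by (simp add: settled_def)
  next
    case False
    have "h v \<le> height v"
      using assms by (simp add: settled_def)
    with False show ?thesis
      by (simp add: height_def)
  qed
qed

lemma settled_initial:
  assumes "\<And>v. h v \<le> height v" "\<And>i. i \<in> {1..p} \<Longrightarrow> big - i \<le> h (c i)"
  shows "settled 0 0 h"
  using assms by (simp add: settled_def)

text \<open>The higher end has the smaller key. For a reached edge, complementing the maximum thus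
  gives the least key of an end, and its residue is the index of the source.\<close>

definition edge_label :: "nat set \<Rightarrow> nat" where
  "edge_label e = (big - Max (height ` e)) mod Suc p"

end

section \<open>Optimal allocations\<close>

lemma finite_edges: "valid_instance X I \<Longrightarrow> finite (edges I)"
  unfolding valid_instance_def by (rule finite_subset[of _ "Pow (nodes I)"]) auto

lemma sym_digraph_of_simps [simp]:
  "verts (sym_digraph_of I) = nodes I"
  "arcs (sym_digraph_of I) = {(u, v). {u, v} \<in> edges I}"
  "tail (sym_digraph_of I) = fst"
  "head (sym_digraph_of I) = snd"
  by (simp_all add: sym_digraph_of_def)

text \<open>\<open>f k\<close> may be infinite where the coefficient is 0; the convention
  \<open>0 * \<infinity> = 0\<close> removes these terms.\<close>

lemma sum_unit_vector:
  assumes "i \<in> A" "finite A" "\<And>k. k \<in> A \<Longrightarrow> y k = (if k = i then 1 else 0)"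
  shows "(\<Sum>k\<in>A. f k * ereal (y k)) = f i"
proof -
  have "(\<Sum>k\<in>A. f k * ereal (y k)) = (\<Sum>k\<in>A. if k = i then f i else 0)"
    using assms(3) by (intro sum.cong) (auto simp flip: zero_ereal_def one_ereal_def)
  then show ?thesis
    using assms(1,2) by simp
qed

locale districting_voronoi = voronoi n m "districts I" a b \<omega> "center I"
  for n m :: nat and a b \<omega> :: "nat \<Rightarrow> nat" and I :: "nat districting" +
  fixes X :: "constraint_group set" and \<Lambda> :: real
  assumes valid: "valid_instance X I"
    and given_centers: "Node_Selection \<notin> X"
    and unbalanced: "Balance \<notin> X"
    and integral: "Integrality \<in> X"
    and has_objective: "Objective \<in> X"
    and nodes_eq: "nodes I = {..<n}"
    and edges_eq: "edges I = (\<lambda>j. {a j, b j}) ` {..<m}"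
    and scale_pos: "0 < \<Lambda>"
    and length_eq: "j < m \<Longrightarrow> weight I {a j, b j} = real (\<omega> j) / \<Lambda>"
begin

abbreviation p :: nat where "p \<equiv> districts I"

sublocale graph: wf_digraph "sym_digraph_of I"
  using valid by unfold_locales (auto simp: valid_instance_def)

abbreviation arc_weight :: "nat \<times> nat \<Rightarrow> real" where
  "arc_weight \<equiv> \<lambda>(j, k). weight I {j, k}"

section \<open>Distances as infima over integer walk lengths\<close>

lemma awalk_of_walk_length:
  assumes "walk_length s v l" "s < n"
  shows "\<exists>q. graph.awalk s q v \<and> graph.awalk_cost arc_weight q = real l / \<Lambda>"
  using assms
proof (induction rule: walk_length.induct)
  case start
  then show ?case
    by (intro exI[of _ "[]"]) (simp add: graph.awalk_Nil_iff nodes_eq)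
next
  case (step u k j v)
  then obtain q where q: "graph.awalk s q u" "graph.awalk_cost arc_weight q = real k / \<Lambda>"
    by blast
  have "v < n"
    using walk_length_less walk_length.step step by blast
  moreover have "{u, v} \<in> edges I"
    using step edges_eq by auto
  ultimately have "graph.awalk u [(u, v)] v"
    by (simp add: graph.awalk_simps nodes_eq)
  with q(1) have "graph.awalk s (q @ [(u, v)]) v"
    by (rule graph.awalk_appendI)
  moreover have "graph.awalk_cost arc_weight (q @ [(u, v)]) = real (k + \<omega> j) / \<Lambda>"
    using q(2) step length_eq[of j] by (simp add: add_divide_distrib)
  ultimately show ?case by blast
qed

text \<open>The prefix from \<open>s\<close> to \<open>u\<close> generalizes the induction, because
  directed walks are decomposed at their first arc while \<open>walk_length\<close> grows at the
  end.\<close>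

lemma walk_length_of_awalk:
  assumes "graph.awalk u q v" "walk_length s u k"
  shows "\<exists>l. walk_length s v l \<and> real l / \<Lambda> = real k / \<Lambda> + graph.awalk_cost arc_weight q"
  using assms
proof (induction q arbitrary: u k)
  case Nil
  then show ?case by (auto simp: graph.awalk_Nil_iff)
next
  case (Cons e q)
  then obtain w where e: "e = (u, w)" "{u, w} \<in> edges I" and q: "graph.awalk w q v"
    by (cases e) (auto simp: graph.awalk_Cons_iff)
  then obtain j where j: "j < m" "{u, w} = {a j, b j}"
    using edges_eq by auto
  then have "walk_length s w (k + \<omega> j)"
    using Cons.prems(2) walk_length.step by blast
  with Cons.IH[OF q] obtain l where
    "walk_length s v l" "real l / \<Lambda> = real (k + \<omega> j) / \<Lambda> + graph.awalk_cost arc_weight q"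
    by blast
  with j e show ?case
    using length_eq[of j] by (auto simp: add_divide_distrib)
qed

lemma node_dist_le:
  assumes "walk_length s v l" "s < n"
  shows "node_dist I s v \<le> ereal (real l / \<Lambda>)"
  using awalk_of_walk_length[OF assms] graph.min_cost_le_walk_cost
  unfolding node_dist_def by metis

text \<open>The empty infimum is included: without walks the premise is vacuous, as befits the
  distance \<open>\<infinity>\<close>.\<close>

lemma node_dist_ge:
  assumes "\<And>l. walk_length s v l \<Longrightarrow> r \<le> ereal (real l / \<Lambda>)"
  shows "r \<le> node_dist I s v"
  unfolding node_dist_def graph.\<mu>_def
proof (rule INF_greatest)
  fix q
  assume "q \<in> {q. graph.awalk s q v}"
  then obtain l where "walk_length s v l" "real l / \<Lambda> = graph.awalk_cost arc_weight q"
    using walk_length_of_awalk[OF _ walk_length.start, of s q v] by auto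
  then show "r \<le> ereal (graph.awalk_cost arc_weight q)"
    using assms by metis
qed

lemma edge_cases:
  assumes "e \<in> edges I"
  obtains j where "j < m" "e = {a j, b j}"
  using assms edges_eq by auto

lemma edge_nonempty: "e \<in> edges I \<Longrightarrow> finite e \<and> e \<noteq> {}"
  using edges_eq by auto

lemma top_vertex:
  assumes "e \<in> edges I"
  obtains v where "v \<in> e" "height v = Max (height ` e)"
proof -
  have "Max (height ` e) \<in> height ` e"
    using edge_nonempty[OF assms] by (intro Max_in) auto
  then obtain v where "v \<in> e" "Max (height ` e) = height v"
    by (rule imageE)
  then show thesis
    using that[of v] by simp
qed

lemma edge_label_unreached: "Max (height ` e) = 0 \<Longrightarrow> edge_label e = 1"
  using sources unfolding edge_label_def big_def by (simp only: mod_mult_self2 diff_zero) simp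

lemma edge_label_reached:
  assumes "e \<in> edges I" "0 < Max (height ` e)"
  obtains v l where "v \<in> e" "height v = Max (height ` e)" "edge_label e \<in> {1..p}"
    "walk_length (center I (edge_label e)) v l" "min_key v = edge_label e + Suc p * l"
proof -
  obtain v where v: "v \<in> e" "height v = Max (height ` e)"
    using assms(1) by (rule top_vertex)
  then have "reached v"
    using assms(2) height_pos_iff by metis
  then have "key v (min_key v)" and e: "edge_label e = min_key v mod Suc p"
    using v(2) key_min_key height_reached unfolding edge_label_def by metis+
  then obtain i l where il: "i \<in> {1..p}" "walk_length (center I i) v l" "min_key v = i + Suc p * l"
    unfolding key_def by blast
  moreover have "(i + Suc p * l) mod Suc p = i"
    using il(1) by (subst mod_mult_self2) simp
  ultimately show thesis
    using that[of v l] v e by simp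
qed

lemma edge_label_in: "e \<in> edges I \<Longrightarrow> edge_label e \<in> {1..p}"
  using edge_label_unreached[of e] edge_label_reached[of e] sources
  by (cases "Max (height ` e) = 0") (simp, blast)

text \<open>The label comes from the least key of an end of \<open>e\<close>, and comparing keys
  compares lengths because the indices differ by less than \<open>Suc p\<close>. For an edge out of
  reach there is no walk to compare with.\<close>

lemma Min_node_dist_le:
  assumes e: "e \<in> edges I" and i: "i \<in> {1..p}"
  shows "Min (node_dist I (center I (edge_label e)) ` e) \<le> Min (node_dist I (center I i) ` e)"
proof -
  have "Min (node_dist I (center I (edge_label e)) ` e) \<le> node_dist I (center I i) u" if u: "u \<in> e" for u
  proof (rule node_dist_ge)
    fix k
    assume k: "walk_length (center I i) u k"
    then have key: "key u (i + Suc p * k)"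
      using i unfolding key_def by blast
    have "height u \<le> Max (height ` e)"
      using u e edge_nonempty by simp
    moreover have "0 < height u"
      using key reachedI height_pos_iff by blast
    ultimately have "0 < Max (height ` e)"
      by simp
    with e obtain v l where v: "v \<in> e" "height v = Max (height ` e)" "edge_label e \<in> {1..p}"
      "walk_length (center I (edge_label e)) v l" "min_key v = edge_label e + Suc p * l"
      by (rule edge_label_reached)
    have "reached u" "reached v"
      using \<open>0 < height u\<close> \<open>0 < Max (height ` e)\<close> v(2) height_pos_iff by metis+
    then have "min_key v = big - height v" "min_key u = big - height u"
      using height_reached by simp_all
    then have "min_key v \<le> min_key u"
      using \<open>height u \<le> _\<close> v(2) by (simp add: diff_le_mono2)
    also have "\<dots> \<le> i + Suc p * k"
      using key by (rule min_key_le)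
    \<comment> \<open>Strict because the label is at least 1 and \<open>i\<close> is at most
      \<open>p\<close>.\<close>
    finally have "Suc p * l < Suc p * Suc k"
      using v(3,5) i by simp
    then have "l \<le> k"
      by (simp only: Suc_mult_less_cancel1 less_Suc_eq_le)
    have "Min (node_dist I (center I (edge_label e)) ` e) \<le> node_dist I (center I (edge_label e)) v"
      using v(1) e edge_nonempty by simp
    also have "\<dots> \<le> ereal (real l / \<Lambda>)"
      using v(3,4) source_less by (intro node_dist_le)
    also have "\<dots> \<le> ereal (real k / \<Lambda>)"
      using \<open>l \<le> k\<close> scale_pos by (simp add: divide_right_mono)
    finally show "Min (node_dist I (center I (edge_label e)) ` e) \<le> ereal (real k / \<Lambda>)" .
  qed
  then show ?thesis
    using e edge_nonempty by simp
qed

section \<open>Feasibility and optimality of the nearest-center allocation\<close>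

definition allocation :: "nat \<Rightarrow> nat set \<Rightarrow> real" where
  "allocation i e = of_bool (edge_label e = i)"

definition indicator_center :: "nat \<Rightarrow> nat \<Rightarrow> real" where
  "indicator_center i v = of_bool (v = center I i)"

lemma center_in: "i \<in> {1..p} \<Longrightarrow> center I i \<in> nodes I"
  using source_less nodes_eq by auto

text \<open>
  The edge of \<open>D\<close> with the smallest key is entered through a predecessor edge, which has a smaller
  key and the same label and hence lies in the boundary of \<open>D\<close>.
\<close>

lemma contiguous:
  assumes reached: "\<And>e. e \<in> edges I \<Longrightarrow> 0 < Max (height ` e)"
    and D: "D \<subseteq> edges I" "D \<noteq> {}" and i: "i \<in> {1..p}"
  shows "1 \<le> (\<Sum>e\<in>boundary I D. allocation i e) + (\<Sum>e\<in>D. 1 - allocation i e) +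
    (\<Sum>v\<in>\<Union>D. indicator_center i v)"
proof -
  have fin: "finite D" "finite (boundary I D)"
    using finite_edges[OF valid] D(1) finite_subset by (auto simp: boundary_def)
  then have finU: "finite (\<Union>D)"
    using D(1) edge_nonempty by auto
  have nonneg: "0 \<le> (\<Sum>e\<in>boundary I D. allocation i e)" "0 \<le> (\<Sum>e\<in>D. 1 - allocation i e)"
    "0 \<le> (\<Sum>v\<in>\<Union>D. indicator_center i v)"
    by (auto intro!: sum_nonneg simp: allocation_def indicator_center_def)
  consider (outside) e where "e \<in> D" "edge_label e \<noteq> i" | (inside) "\<forall>e\<in>D. edge_label e = i"
    by blast
  then show ?thesis
  proof cases
    case outside
    then have "1 \<le> (\<Sum>e\<in>D. 1 - allocation i e)"
      using fin(1) member_le_sum[of e D "\<lambda>e. 1 - allocation i e"] by (auto simp: allocation_def)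
    then show ?thesis
      using nonneg by simp
  next
    case inside
    let ?height = "\<lambda>e. Max (height ` e)"
    have "Max (?height ` D) \<in> ?height ` D"
      using fin(1) D(2) by (intro Max_in) auto
    then obtain e where "e \<in> D" "Max (?height ` D) = ?height e"
      by (rule imageE)
    then have e: "e \<in> D" "\<And>f. f \<in> D \<Longrightarrow> ?height f \<le> ?height e"
      using fin(1) Max_ge[of "?height ` D"] by auto
    then have "e \<in> edges I" and label: "edge_label e = i"
      using D(1) inside by auto
    from this(1) reached[OF this(1)] obtain v l where
      v: "v \<in> e" "height v = Max (height ` e)" "walk_length (center I i) v l" "min_key v = i + Suc p * l"
      by (rule edge_label_reached) (simp add: label)
    then have "reached v"
      using reached[OF \<open>e \<in> edges I\<close>] height_pos_iff[of v] by simp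
    then show ?thesis
    proof (cases rule: min_key_cases)
      case (source i')
      \<comment> \<open>A key that is a mere source index is at most \<open>p\<close>, which leaves
        no room for a positive length; hence \<open>i' = i\<close>.\<close>
      then have "Suc p * l < Suc p * 1"
        using v(4) i by simp
      then have "l = 0"
        by (simp only: Suc_mult_less_cancel1 less_one)
      then have "v = center I i"
        using source v(4) by simp
      then have "indicator_center i v = 1"
        by (simp add: indicator_center_def)
      moreover have "indicator_center i v \<le> (\<Sum>v\<in>\<Union>D. indicator_center i v)"
        using finU v(1) e(1) by (intro member_le_sum) (auto simp: indicator_center_def)
      ultimately have "1 \<le> (\<Sum>v\<in>\<Union>D. indicator_center i v)"
        by simp
      then show ?thesis
        using nonneg by simp
    next
      case (edge u j)
      let ?f = "{u, v}"
      have f: "?f \<in> edges I"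
        using edge edges_eq by auto
      have "min_key u < min_key v"
        using edge length_pos[of j] by simp
      then have less: "height v < height u"
        using edge(1) \<open>reached v\<close> min_key_less_big[of v] by (simp add: height_def)
      then have max: "Max (height ` ?f) = height u"
        by simp
      then have "?f \<notin> D"
        using e(2) less v(2) by fastforce
      then have "?f \<in> boundary I D"
        using f v(1) e(1) by (auto simp: boundary_def)
      moreover have "edge_label ?f = min_key u mod Suc p"
        using max height_reached[OF edge(1)] by (simp add: edge_label_def)
      then have "edge_label ?f = min_key v mod Suc p"
        using edge(4) by (simp del: mult_Suc)
      then have "edge_label ?f = i"
        using v(4) label max reached[OF \<open>e \<in> edges I\<close>] height_reached[OF \<open>reached v\<close>] v(2)
        by (simp add: edge_label_def)
      ultimately have "1 \<le> (\<Sum>e\<in>boundary I D. allocation i e)"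
        using fin(2) member_le_sum[of ?f "boundary I D" "allocation i"]
        by (auto simp: allocation_def)
      then show ?thesis
        using nonneg by simp
    qed
  qed
qed

lemma feasible_allocation:
  assumes "Contiguity \<in> X \<Longrightarrow> \<forall>e\<in>edges I. 0 < Max (height ` e)"
  shows "feasible X I allocation indicator_center"
  unfolding feasible_def
proof (intro conjI)
  show "\<forall>e\<in>edges I. (\<Sum>i\<in>{1..p}. allocation i e) = 1"
    using edge_label_in by (auto simp: allocation_def of_bool_def sum.delta)
  show "\<forall>i\<in>{1..p}. (\<Sum>v\<in>nodes I. indicator_center i v) = 1"
    using center_in by (auto simp: indicator_center_def of_bool_def sum.delta nodes_eq)
  show "Contiguity \<in> X \<longrightarrow> (\<forall>D i. D \<subseteq> edges I \<and> D \<noteq> {} \<and> i \<in> {1..p} \<longrightarrow>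
      1 \<le> (\<Sum>e\<in>boundary I D. allocation i e) + (\<Sum>e\<in>D. 1 - allocation i e) +
        (\<Sum>v\<in>\<Union>D. indicator_center i v))"
    using assms contiguous by blast
qed (use unbalanced in \<open>auto simp: allocation_def indicator_center_def\<close>)

lemma feasible_contiguity:
  assumes "feasible X I x w" "Contiguity \<in> X" "D \<subseteq> edges I" "D \<noteq> {}" "i \<in> {1..p}"
  shows "1 \<le> (\<Sum>e\<in>boundary I D. x i e) + (\<Sum>e\<in>D. 1 - x i e) + (\<Sum>v\<in>\<Union>D. w i v)"
  using assms by (simp only: feasible_def simp_thms)

lemma feasible_integral:
  assumes "feasible X I x w" "e \<in> edges I"
  shows "(\<Sum>i\<in>{1..p}. x i e) = 1" and "i \<in> {1..p} \<Longrightarrow> x i e \<in> {0, 1}"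
  using assms integral by (simp_all add: feasible_def)

lemma feasible_center:
  assumes "feasible X I x w" "i \<in> {1..p}" "v \<in> nodes I"
  shows "w i v = (if v = center I i then 1 else 0)"
  using assms given_centers by (simp add: feasible_def)

lemma integral_allocation_cases:
  assumes "feasible X I x w" "e \<in> edges I"
  obtains i where "i \<in> {1..p}" "\<And>k. k \<in> {1..p} \<Longrightarrow> x k e = (if k = i then 1 else 0)"
proof -
  have x: "(\<Sum>i\<in>{1..p}. x i e) = 1" "\<And>i. i \<in> {1..p} \<Longrightarrow> x i e \<in> {0, 1}"
    using feasible_integral[OF assms] by blast+
  then obtain i where i: "i \<in> {1..p}" "x i e \<noteq> 0"
    by (metis sum.neutral zero_neq_one)
  then have "x i e = 1"
    using x(2)[OF i(1)] by simp
  then have "(\<Sum>k\<in>{1..p} - {i}. x k e) = 0"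
    using x(1) i(1) by (simp add: sum_diff1)
  moreover have "0 \<le> x k e" if "k \<in> {1..p} - {i}" for k
    using x(2)[of k] that by auto
  ultimately have "\<forall>k\<in>{1..p} - {i}. x k e = 0"
    by (subst (asm) sum_nonneg_eq_0_iff) auto
  then show thesis
    using that[of i] i(1) \<open>x i e = 1\<close> by auto
qed

text \<open>Being unreached spreads along edges. Hence an edge of district \<open>i\<close> that
  meets a vertex of \<open>?D\<close> belongs to \<open>?D\<close> itself, the edges of
  \<open>?D\<close> contribute 0 by construction, and the center of district \<open>i\<close>, being
  reached, is not a vertex of \<open>?D\<close>.\<close>

lemma infeasible:
  assumes "Contiguity \<in> X" and e: "e \<in> edges I" "Max (height ` e) = 0"
  shows "\<not> feasible X I x w"
proof
  assume x: "feasible X I x w"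
  then obtain i where "i \<in> {1..p}" "\<And>k. k \<in> {1..p} \<Longrightarrow> x k e = (if k = i then 1 else 0)"
    using e(1) by (rule integral_allocation_cases) blast
  then have i: "i \<in> {1..p}" "x i e = 1"
    by simp_all
  let ?D = "{f \<in> edges I. x i f = 1 \<and> (\<forall>v\<in>f. height v = 0)}"
  have unreached: "height v = 0" if "j < m" "{u, v} = {a j, b j}" "height u = 0" for u v j
  proof -
    have "reached u" if "reached v"
      using key_step[OF key_min_key[OF that] \<open>j < m\<close>, of u] \<open>{u, v} = _\<close> reachedI
      by (simp add: insert_commute)
    then show ?thesis
      using that(3) height_pos_iff[of u] height_pos_iff[of v] by auto
  qed
  have "height v = 0" if "v \<in> e" for v
    using Max_ge[of "height ` e" "height v"] edge_nonempty[OF e(1)] that e(2) by simp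
  then have "e \<in> ?D"
    using e(1) i(2) by simp
  then have "?D \<noteq> {}"
    by blast
  then have "1 \<le> (\<Sum>f\<in>boundary I ?D. x i f) + (\<Sum>f\<in>?D. 1 - x i f) + (\<Sum>v\<in>\<Union>?D. w i v)"
    using i(1) by (intro feasible_contiguity[OF x assms(1)]) auto
  moreover have "(\<Sum>f\<in>boundary I ?D. x i f) = 0"
  proof (rule sum.neutral, rule ballI)
    fix f
    assume "f \<in> boundary I ?D"
    then obtain v where f: "f \<in> edges I" "f \<notin> ?D" "v \<in> f" "height v = 0"
      unfolding boundary_def by blast
    from f(1) obtain j where "j < m" "f = {a j, b j}"
      by (rule edge_cases)
    then have "\<forall>u\<in>f. height u = 0"
      using f(3,4) unreached[of j v] by (auto simp: insert_commute)
    then show "x i f = 0"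
      using f(1,2) feasible_integral(2)[OF x f(1) i(1)] by auto
  qed
  moreover have "(\<Sum>v\<in>\<Union>?D. w i v) = 0"
  proof (rule sum.neutral, rule ballI)
    fix v
    assume v: "v \<in> \<Union>?D"
    then have "v \<in> nodes I" "height v = 0"
      using valid unfolding valid_instance_def by auto
    moreover have "0 < height (center I i)"
      using key_source[OF i(1)] reachedI height_pos_iff by blast
    ultimately show "w i v = 0"
      using feasible_center[OF x i(1)] by auto
  qed
  ultimately show False by simp
qed

text \<open>Grouping the costs by edges allows each edge to be optimized separately.\<close>

lemma objective_given_centers:
  assumes w: "\<And>i v. i \<in> {1..p} \<Longrightarrow> v \<in> nodes I \<Longrightarrow> w i v = (if v = center I i then 1 else 0)"
  shows "objective X \<alpha> I x w =
    (\<Sum>e\<in>edges I. \<Sum>i\<in>{1..p}. edge_dist \<alpha> I (center I i) e * ereal (x i e))"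
proof -
  have "objective X \<alpha> I x w =
    (\<Sum>i\<in>{1..p}. \<Sum>v\<in>nodes I. \<Sum>e\<in>edges I. ereal (w i v) * edge_dist \<alpha> I v e * ereal (x i e))"
    using has_objective by (simp only: objective_def if_True) (rule sum.swap)
  also have "\<dots> = (\<Sum>i\<in>{1..p}. \<Sum>v\<in>nodes I.
      if v = center I i then \<Sum>e\<in>edges I. edge_dist \<alpha> I (center I i) e * ereal (x i e) else 0)"
    using w by (intro sum.cong) (auto simp flip: zero_ereal_def one_ereal_def)
  also have "\<dots> = (\<Sum>i\<in>{1..p}. \<Sum>e\<in>edges I. edge_dist \<alpha> I (center I i) e * ereal (x i e))"
    using center_in by (intro sum.cong refl) (simp add: nodes_eq)
  also have "\<dots> = (\<Sum>e\<in>edges I. \<Sum>i\<in>{1..p}. edge_dist \<alpha> I (center I i) e * ereal (x i e))"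
    by (rule sum.swap)
  finally show ?thesis .
qed

text \<open>An integral competitor sends each edge to a single center, so the costs compare edge by
  edge, and the labels attain the minimum for every edge at once.\<close>

lemma optimal_allocation:
  assumes "Contiguity \<in> X \<Longrightarrow> \<forall>e\<in>edges I. 0 < Max (height ` e)"
  shows "optimal X \<alpha> I allocation indicator_center"
  unfolding optimal_def
proof (intro conjI allI impI)
  show "feasible X I allocation indicator_center"
    using assms by (rule feasible_allocation)
  fix x w
  assume x: "feasible X I x w"
  have "(\<Sum>i\<in>{1..p}. edge_dist \<alpha> I (center I i) e * ereal (allocation i e))
      \<le> (\<Sum>i\<in>{1..p}. edge_dist \<alpha> I (center I i) e * ereal (x i e))" if e: "e \<in> edges I" for e
  proof -
    obtain i where i: "i \<in> {1..p}" "\<And>k. k \<in> {1..p} \<Longrightarrow> x k e = (if k = i then 1 else 0)"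
      using x e by (rule integral_allocation_cases) blast
    have "(\<Sum>i\<in>{1..p}. edge_dist \<alpha> I (center I i) e * ereal (allocation i e)) =
        edge_dist \<alpha> I (center I (edge_label e)) e"
      using edge_label_in[OF e] by (intro sum_unit_vector) (auto simp: allocation_def)
    also have "\<dots> \<le> edge_dist \<alpha> I (center I i) e"
      unfolding edge_dist_def using Min_node_dist_le[OF e i(1)] by (rule add_right_mono)
    also have "\<dots> = (\<Sum>i\<in>{1..p}. edge_dist \<alpha> I (center I i) e * ereal (x i e))"
      using i by (intro sum_unit_vector[symmetric]) auto
    finally show ?thesis .
  qed
  then have "objective X \<alpha> I allocation indicator_center \<le>
      (\<Sum>e\<in>edges I. \<Sum>i\<in>{1..p}. edge_dist \<alpha> I (center I i) e * ereal (x i e))"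
    by (subst objective_given_centers) (auto simp: indicator_center_def intro: sum_mono)
  also have "\<dots> = objective X \<alpha> I x w"
    using feasible_center[OF x] by (rule objective_given_centers[symmetric])
  finally show "objective X \<alpha> I allocation indicator_center \<le> objective X \<alpha> I x w" .
qed

end

section \<open>The program\<close>

abbreviation var :: "nat \<Rightarrow> aexp" where
  "var k \<equiv> Cell k (Num 0)"

definition set_var :: "nat \<Rightarrow> aexp \<Rightarrow> com" where
  "set_var k a = Assign k (Num 0) a"

text \<open>
  Arrays 2 to 6 hold the numbers of vertices, edges and districts, the product of all denominators
  and the number \<open>big\<close>; arrays 7 and 8 hold loop indices, where 8 always counts edges or vertices;
  array 9 counts unreached edges, and array 10 holds the heights.
\<close>

definition edge_field :: "nat \<Rightarrow> aexp" where
  "edge_field r = Cell 0 (Plus (Plus (var 2) (Num r)) (Times (Num 5) (var 8)))"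

text \<open>The input word starts in cell 1 with its length in cell 0. Relative to cell
  \<open>n + 5 * j\<close>, edge \<open>j\<close> has its ends at offsets 3 and 4, its sign at 5,
  and numerator and denominator at 6 and 7. The division is exact because each denominator divides
  the product of all.\<close>

definition edge_length :: aexp where
  "edge_length = Times (edge_field 6) (Div (var 5) (edge_field 7))"

definition district_center :: aexp where
  "district_center = Cell 0 (Plus (Plus (var 2) (Num 4)) (Plus (Times (Num 5) (var 3)) (var 7)))"

definition max_exp :: "aexp \<Rightarrow> aexp \<Rightarrow> aexp" where
  "max_exp x y = Plus x (Minus y x)"

definition eq_exp :: "aexp \<Rightarrow> aexp \<Rightarrow> aexp" where
  "eq_exp x y = Minus (Num 1) (Plus (Minus x y) (Minus y x))"

definition mod_exp :: "aexp \<Rightarrow> aexp \<Rightarrow> aexp" where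
  "mod_exp x y = Minus x (Times y (Div x y))"

definition label_exp :: aexp where
  "label_exp = mod_exp (Minus (var 6) (max_exp (Cell 10 (edge_field 3)) (Cell 10 (edge_field 4))))
     (Plus (var 4) (Num 1))"

lemma aval_max_exp [simp]: "aval (max_exp x y) s = max (aval x s) (aval y s)"
  by (simp add: max_exp_def max_def)

lemma aval_eq_exp [simp]: "aval (eq_exp x y) s = of_bool (aval x s = aval y s)"
  by (auto simp: eq_exp_def)

lemma aval_mod_exp [simp]: "aval (mod_exp x y) s = aval x s mod aval y s"
  by (simp add: mod_exp_def minus_mult_div_eq_mod)

definition load :: com where
  "load = Seq (set_var 2 (Cell 0 (Num 1)))
     (Seq (set_var 3 (Cell 0 (Plus (var 2) (Num 2))))
       (set_var 4 (Cell 0 (Plus (Plus (var 2) (Num 3)) (Times (Num 5) (var 3))))))"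

definition scale_lengths :: com where
  "scale_lengths = Seq (set_var 5 (Num 1)) (For 8 (var 3) (set_var 5 (Times (var 5) (edge_field 7))))"

definition compute_big :: com where
  "compute_big = Seq (set_var 6 (Num 1))
     (Seq (For 8 (var 3) (set_var 6 (Plus (var 6) (Times (var 2) edge_length))))
       (set_var 6 (Plus (Num 1) (Times (Plus (var 4) (Num 1)) (var 6)))))"

text \<open>Centers may coincide. The maximum keeps the greatest height, that is, the smallest
  index; the loop counts from 0 and districts from 1.\<close>

definition init_heights :: com where
  "init_heights = For 7 (var 4)
     (Assign 10 district_center
       (max_exp (Cell 10 district_center) (Minus (var 6) (Plus (var 7) (Num 1)))))"

definition relax_com :: "nat \<Rightarrow> nat \<Rightarrow> com" where
  "relax_com q r = Assign 10 (edge_field r) (max_exp (Cell 10 (edge_field r))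
     (Minus (Cell 10 (edge_field q)) (Times (Plus (var 4) (Num 1)) edge_length)))"

definition bellman_ford :: com where
  "bellman_ford = For 7 (var 2) (For 8 (var 3) (Seq (relax_com 3 4) (relax_com 4 3)))"

definition count_unreached :: com where
  "count_unreached = For 8 (var 3) (set_var 9 (Plus (var 9)
     (eq_exp (Num 0) (Plus (Cell 10 (edge_field 3)) (Cell 10 (edge_field 4))))))"

text \<open>Each share is written as a rational: sign 0, numerator 0 or 1, denominator 1.\<close>

definition emit_allocation :: com where
  "emit_allocation = For 7 (var 4) (For 8 (var 3)
     (Seq (Emit (Num 0)) (Seq (Emit (eq_exp label_exp (Plus (var 7) (Num 1)))) (Emit (Num 1)))))"

definition emit_centers :: com where
  "emit_centers = For 7 (var 4) (For 8 (var 2) (Emit (eq_exp (var 8) district_center)))"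

text \<open>Contiguity is fixed with the problem and hence a literal of the program; the product in
  the test is a conjunction.\<close>

definition program :: "bool \<Rightarrow> com" where
  "program contiguous = Seq load (Seq scale_lengths (Seq compute_big (Seq init_heights
     (Seq bellman_ford (Seq count_unreached
       (If (Times (Num (of_bool contiguous)) (var 9)) (Emit (Num 0))
         (Seq (Emit (Num 1)) (Seq emit_allocation emit_centers))))))))"

section \<open>Verification of the program\<close>

lemma output_word_upd [simp]: "k \<noteq> 1 \<Longrightarrow> output_word (s(k := f)) = output_word s"
  by (simp add: output_word_def)

lemma wp_set_var:
  "aval a s \<le> 2 ^ X \<Longrightarrow> Q (s(k := (s k)(0 := aval a s))) \<Longrightarrow> wp X (set_var k a) Q s"
  unfolding set_var_def by (rule wp_Assign) auto

text \<open>Loop counts are bounded by \<open>X\<close>, stored values by \<open>2 ^ X\<close>.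
  Partial products of denominators are included because each of them is stored.\<close>

locale voronoi_input = voronoi +
  fixes inp numer denom :: "nat \<Rightarrow> nat" and X :: nat
  assumes inp_n: "inp 1 = n"
    and inp_m: "inp (n + 2) = m"
    and inp_a: "j < m \<Longrightarrow> inp (n + 3 + 5 * j) = a j"
    and inp_b: "j < m \<Longrightarrow> inp (n + 4 + 5 * j) = b j"
    and inp_numer: "j < m \<Longrightarrow> inp (n + 6 + 5 * j) = numer j"
    and inp_denom: "j < m \<Longrightarrow> inp (n + 7 + 5 * j) = denom j"
    and inp_p: "inp (n + 3 + 5 * m) = p"
    and inp_c: "i < p \<Longrightarrow> inp (n + 4 + (5 * m + i)) = c (Suc i)"
    and length_numer: "j < m \<Longrightarrow> \<omega> j = numer j * ((\<Prod>k<m. denom k) div denom j)"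
    and n_le: "n \<le> X" and m_le: "m \<le> X" and p_le: "p \<le> X"
    and prod_le: "k \<le> m \<Longrightarrow> (\<Prod>j<k. denom j) \<le> 2 ^ X"
    and big_le: "big \<le> 2 ^ X"
    and output_le: "1 + 3 * (p * m) + p * n \<le> 2 ^ X"
begin

definition loaded :: "memory \<Rightarrow> bool" where
  "loaded s \<longleftrightarrow> s 0 = inp \<and> s 2 0 = n \<and> s 3 0 = m \<and> s 4 0 = p"

definition scaled :: "memory \<Rightarrow> bool" where
  "scaled s \<longleftrightarrow> loaded s \<and> s 5 0 = (\<Prod>j<m. denom j)"

definition blank :: "memory \<Rightarrow> bool" where
  "blank s \<longleftrightarrow> output_word s = [] \<and> s 9 0 = 0"

definition solved :: "memory \<Rightarrow> bool" where
  "solved s \<longleftrightarrow> loaded s \<and> s 6 0 = big \<and> s 10 = height"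

lemma small_le [simp]: "n \<le> 2 ^ X" "m \<le> 2 ^ X" "p \<le> 2 ^ X" "1 \<le> (2::nat) ^ X"
proof -
  have "X \<le> 2 ^ X"
    by (simp add: less_imp_le)
  then show "n \<le> 2 ^ X" "m \<le> 2 ^ X" "p \<le> 2 ^ X"
    using n_le m_le p_le by linarith+
qed simp

lemma aval_edge_field:
  assumes "loaded s" "s 8 0 = j" "j < m"
  shows "aval (edge_field 3) s = a j" "aval (edge_field 4) s = b j"
    "aval (edge_field 6) s = numer j" "aval (edge_field 7) s = denom j"
  using assms by (simp_all add: loaded_def edge_field_def inp_a inp_b inp_numer inp_denom)

lemma aval_edge_length:
  assumes "scaled s" "s 8 0 = j" "j < m"
  shows "aval edge_length s = \<omega> j"
  using assms aval_edge_field[of s j] by (simp add: scaled_def edge_length_def length_numer)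

lemma aval_district_center:
  assumes "loaded s" "s 7 0 = i" "i < p"
  shows "aval district_center s = c (Suc i)"
  using assms by (simp add: loaded_def district_center_def inp_c)

lemma loaded_upd [simp]: "k \<notin> {0, 2, 3, 4} \<Longrightarrow> loaded (s(k := f)) = loaded s"
  by (auto simp: loaded_def)

lemma loaded_emit [simp]: "loaded (emit v s) = loaded s"
  by (simp add: loaded_def)

lemma scaled_upd [simp]: "k \<notin> {0, 2, 3, 4, 5} \<Longrightarrow> scaled (s(k := f)) = scaled s"
  by (auto simp: scaled_def)

lemma blank_upd [simp]: "k \<notin> {1, 9} \<Longrightarrow> blank (s(k := f)) = blank s"
  by (auto simp: blank_def)

lemma solved_upd [simp]: "k \<notin> {0, 2, 3, 4, 6, 10} \<Longrightarrow> solved (s(k := f)) = solved s"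
  by (auto simp: solved_def)

lemma solved_emit [simp]: "solved (emit v s) = solved s"
  by (simp add: solved_def)

lemma wp_load:
  assumes "s 0 = inp" "\<And>s'. loaded s' \<Longrightarrow> (\<And>k. k \<notin> {2, 3, 4} \<Longrightarrow> s' k = s k) \<Longrightarrow> Q s'"
  shows "wp X load Q s"
  unfolding load_def
  by (intro wp_Seq wp_set_var assms(2)) (use assms(1) inp_n inp_m inp_p in \<open>auto simp: loaded_def\<close>)

lemma wp_scale_lengths:
  assumes "loaded s" "blank s" "s 10 = (\<lambda>_. 0)"
    "\<And>s. scaled s \<Longrightarrow> blank s \<Longrightarrow> s 10 = (\<lambda>_. 0) \<Longrightarrow> Q s"
  shows "wp X scale_lengths Q s"
  unfolding scale_lengths_def
proof (rule wp_Seq, rule wp_set_var, simp, rule wp_For[where n = m and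
      I = "\<lambda>k s. loaded s \<and> blank s \<and> s 10 = (\<lambda>_. 0) \<and> s 5 0 = (\<Prod>j<k. denom j)"], goal_cases)
  case (5 k s)
  then show ?case
    using prod_le[of "Suc k"] aval_edge_field[of s k]
    by (intro wp_set_var) auto
qed (use assms m_le in \<open>auto simp: loaded_def scaled_def\<close>)

text \<open>Keeps the sums stored on the way to \<open>big\<close> within the cell bound.\<close>

lemma partial_sum_le: "k \<le> m \<Longrightarrow> 1 + n * (\<Sum>j<k. \<omega> j) \<le> big"
proof -
  assume "k \<le> m"
  then have "(\<Sum>j<k. \<omega> j) \<le> (\<Sum>j<m. \<omega> j)"
    by (intro sum_mono2) auto
  then have "1 + n * (\<Sum>j<k. \<omega> j) \<le> 1 * (1 + n * (\<Sum>j<m. \<omega> j))"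
    by simp
  also have "\<dots> \<le> Suc p * (1 + n * (\<Sum>j<m. \<omega> j))"
    by (intro mult_le_mono1) simp
  finally show ?thesis
    unfolding big_def by simp
qed

lemma wp_compute_big:
  assumes "scaled s" "blank s" "s 10 = (\<lambda>_. 0)"
    "\<And>s. scaled s \<Longrightarrow> blank s \<Longrightarrow> s 10 = (\<lambda>_. 0) \<Longrightarrow> s 6 0 = big \<Longrightarrow> Q s"
  shows "wp X compute_big Q s"
  unfolding compute_big_def
proof (rule wp_Seq, rule wp_set_var, simp, rule wp_Seq, rule wp_For[where n = m and
      I = "\<lambda>k s. scaled s \<and> blank s \<and> s 10 = (\<lambda>_. 0) \<and> s 6 0 = 1 + n * (\<Sum>j<k. \<omega> j)"], goal_cases)
  case (5 k s)
  then have "1 + n * (\<Sum>j<Suc k. \<omega> j) \<le> 2 ^ X"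
    using partial_sum_le[of "Suc k"] big_le by linarith
  with 5 show ?case
    using aval_edge_length[of s k]
    by (intro wp_set_var) (auto simp: scaled_def loaded_def algebra_simps)
next
  case (6 s)
  then have "aval (Plus (Num 1) (Times (Plus (var 4) (Num 1)) (var 6))) s = big"
    unfolding big_def by (simp add: scaled_def loaded_def)
  with 6 big_le show ?case
    by (intro wp_set_var assms(4)) auto
qed (use assms m_le in \<open>auto simp: loaded_def scaled_def\<close>)

lemma wp_init_heights:
  assumes "scaled s" "blank s" "s 10 = (\<lambda>_. 0)" "s 6 0 = big"
    "\<And>s. scaled s \<Longrightarrow> blank s \<Longrightarrow> s 6 0 = big \<Longrightarrow> settled 0 0 (s 10) \<Longrightarrow> Q s"
  shows "wp X init_heights Q s"
  unfolding init_heights_def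
proof (rule wp_For[where n = p and I = "\<lambda>k s. scaled s \<and> blank s \<and> s 6 0 = big \<and>
      (\<forall>v. s 10 v \<le> height v) \<and> (\<forall>i\<in>{1..k}. big - i \<le> s 10 (c i))"], goal_cases)
  case (5 k s)
  then have c: "aval district_center s = c (Suc k)"
    by (intro aval_district_center) (auto simp: scaled_def)
  let ?h = "(s 10)(c (Suc k) := max (s 10 (c (Suc k))) (big - Suc k))"
  have h: "?h v \<le> height v" for v
    using 5 height_source[of "Suc k"] by auto
  then have "?h v \<le> 2 ^ X" for v
    using height_le_big big_le le_trans by blast
  from this[of "c (Suc k)"] have "max (s 10 (c (Suc k))) (big - Suc k) \<le> 2 ^ X"
    by simp
  moreover have "big - i \<le> ?h (c i)" if "i \<in> {1..Suc k}" for i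
  proof (cases "i = Suc k")
    case False
    then have "big - i \<le> s 10 (c i)"
      using 5 that by simp
    also have "\<dots> \<le> ?h (c i)"
      by simp
    finally show ?thesis .
  qed simp
  ultimately show ?case
    using 5 c h by (intro wp_Assign) (simp_all del: fun_upd_apply add: fun_upd_same fun_upd_other)
qed (use assms p_le settled_initial in \<open>auto simp: loaded_def scaled_def\<close>)

lemma aval_relax:
  assumes "scaled s" "s 8 0 = j" "j < m"
  shows "aval (Minus (Cell 10 (edge_field q)) (Times (Plus (var 4) (Num 1)) edge_length)) s =
    s 10 (aval (edge_field q) s) - Suc p * \<omega> j"
  using assms aval_edge_length[OF assms] by (simp add: scaled_def loaded_def)

text \<open>That no entry exceeds its final height doubles as the size bound for the stored value,
  as heights are at most \<open>big\<close>.\<close>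

lemma wp_relax_com:
  assumes s: "scaled s" "s 8 0 = j" "j < m" and qr: "{q, r} = {3, 4}"
    and le: "\<And>v. s 10 v \<le> height v"
    and Q: "Q (s(10 := relax j (aval (edge_field q) s) (aval (edge_field r) s) (s 10)))"
  shows "wp X (relax_com q r) Q s"
proof -
  let ?u = "aval (edge_field q) s" and ?v = "aval (edge_field r) s"
  have "loaded s"
    using s(1) by (simp add: scaled_def)
  moreover have "q = 3 \<and> r = 4 \<or> q = 4 \<and> r = 3"
    using qr by (auto simp: doubleton_eq_iff)
  ultimately have "{?u, ?v} = {a j, b j}"
    using s(2,3) by (elim disjE) (simp_all add: aval_edge_field insert_commute)
  then have "relax j ?u ?v (s 10) ?v \<le> height ?v"
    using le s(3) by (intro relax_le_height) auto
  also have "\<dots> \<le> 2 ^ X"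
    using height_le_big big_le le_trans by blast
  finally have "relax j ?u ?v (s 10) ?v \<le> 2 ^ X" .
  moreover have "aval (max_exp (Cell 10 (edge_field r)) (Minus (Cell 10 (edge_field q))
      (Times (Plus (var 4) (Num 1)) edge_length))) s = relax j ?u ?v (s 10) ?v"
    by (simp only: aval_max_exp aval_relax[OF s] aval.simps(2) relax_def fun_upd_same)
  ultimately show ?thesis
    unfolding relax_com_def using Q
    by (intro wp_Assign) (simp_all only: relax_def fun_upd_same)
qed

lemma wp_bellman_ford:
  assumes "scaled s" "blank s" "s 6 0 = big" "settled 0 0 (s 10)"
    "\<And>s. solved s \<Longrightarrow> blank s \<Longrightarrow> Q s"
  shows "wp X bellman_ford Q s"
  unfolding bellman_ford_def
proof (rule wp_For[where n = n and I = "\<lambda>r s. scaled s \<and> blank s \<and> s 6 0 = big \<and> settled r 0 (s 10)"],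
    goal_cases)
  case (5 r s)
  show ?case
  proof (rule wp_For[where n = m and I = "\<lambda>j s. s 7 0 = r \<and> scaled s \<and> blank s \<and> s 6 0 = big \<and>
        settled r j (s 10)"], goal_cases)
    case (5 j s)
    then have s: "scaled s" "loaded s" "s 8 0 = j" "j < m" and settled: "settled r j (s 10)"
      by (auto simp: scaled_def)
    have le: "s 10 v \<le> height v" for v
      using settled by (simp add: settled_def)
    have "relax j (a j) (b j) (s 10) v \<le> height v" for v
      using le s(4) by (rule relax_le_height) simp
    with 5 s le settled_relax[OF settled s(4)] show ?case
      by (intro wp_Seq wp_relax_com[where j = j]) (auto simp: aval_edge_field)
  next
    case (6 s)
    then show ?case
      by (auto intro: settled_Suc)
  qed (use 5 m_le in \<open>auto simp: loaded_def scaled_def\<close>)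
next
  case (6 s)
  then show ?case
    using settled_final by (intro assms(5)) (auto simp: solved_def scaled_def)
qed (use assms n_le in \<open>auto simp: loaded_def scaled_def\<close>)

text \<open>The invariant \<open>s 9 0 \<le> k\<close> keeps the counter within the cell bound;
  afterwards only whether it is 0 matters.\<close>

lemma wp_count_unreached:
  assumes "solved s" "blank s"
    "\<And>s. solved s \<Longrightarrow> output_word s = [] \<Longrightarrow>
      s 9 0 = 0 \<longleftrightarrow> (\<forall>j<m. height (a j) \<noteq> 0 \<or> height (b j) \<noteq> 0) \<Longrightarrow> Q s"
  shows "wp X count_unreached Q s"
  unfolding count_unreached_def
proof (rule wp_For[where n = m and I = "\<lambda>k s. solved s \<and> output_word s = [] \<and> s 9 0 \<le> k \<and>
      (s 9 0 = 0 \<longleftrightarrow> (\<forall>j<k. height (a j) \<noteq> 0 \<or> height (b j) \<noteq> 0))"], goal_cases)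
  case (5 k s)
  then have "aval (edge_field 3) s = a k" "aval (edge_field 4) s = b k"
    by (auto simp: solved_def aval_edge_field)
  moreover have "Suc k \<le> 2 ^ X"
    using 5(1) small_le(2) by linarith
  ultimately show ?case
    using 5 by (intro wp_set_var) (auto simp: solved_def less_Suc_eq)
qed (use assms m_le in \<open>auto simp: loaded_def solved_def blank_def\<close>)

definition allocation_word :: "nat \<Rightarrow> nat \<Rightarrow> nat list" where
  "allocation_word i k = concat (map (\<lambda>j. [0, of_bool (edge_label {a j, b j} = Suc i), 1]) [0..<k])"

definition center_word :: "nat \<Rightarrow> nat \<Rightarrow> nat list" where
  "center_word i k = map (\<lambda>v. of_bool (v = c (Suc i))) [0..<k]"

lemma length_allocation_word: "length (allocation_word i k) = 3 * k"
  by (simp add: allocation_word_def length_concat o_def sum_list_triv)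

lemma length_allocation_words: "length (concat (map (\<lambda>i. allocation_word i m) [0..<k])) = 3 * (k * m)"
  by (simp add: length_concat o_def sum_list_triv length_allocation_word)

lemma length_center_word: "length (center_word i k) = k"
  by (simp add: center_word_def)

lemma length_center_words: "length (concat (map (\<lambda>i. center_word i n) [0..<k])) = k * n"
  by (simp add: length_concat o_def sum_list_triv length_center_word)

lemma aval_label_exp:
  assumes "solved s" "s 8 0 = j" "j < m"
  shows "aval label_exp s = edge_label {a j, b j}"
  using assms by (simp add: label_exp_def edge_label_def aval_edge_field solved_def loaded_def)

lemma wp_emit_allocation:
  assumes "solved s" "output_word s = [1]"
    "\<And>s. solved s \<Longrightarrow> output_word s = 1 # concat (map (\<lambda>i. allocation_word i m) [0..<p]) \<Longrightarrow> Q s"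
  shows "wp X emit_allocation Q s"
  unfolding emit_allocation_def
proof (rule wp_For[where n = p and I = "\<lambda>k s. solved s \<and>
      output_word s = 1 # concat (map (\<lambda>i. allocation_word i m) [0..<k])"], goal_cases)
  case (5 k s)
  then have k: "k < p" by simp
  show ?case
  proof (rule wp_For[where n = m and I = "\<lambda>j s. s 7 0 = k \<and> solved s \<and>
      output_word s = 1 # concat (map (\<lambda>i. allocation_word i m) [0..<k]) @ allocation_word k j"],
      goal_cases)
    case (5 j s)
    \<comment> \<open>Even with the three entries about to be written, the output is no longer than
      the complete allocation part, which \<open>output_le\<close> bounds.\<close>
    have "3 * (k * m) + 3 * Suc j \<le> 3 * (Suc k * m)"
      using 5 by simp
    also have "\<dots> \<le> 3 * (p * m)"
      using k by (intro mult_le_mono2 mult_le_mono1) simp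
    finally have "3 + length (output_word s) \<le> 2 ^ X"
      using 5 output_le by (simp add: length_allocation_word length_allocation_words)
    \<comment> \<open>The label is evaluated after the first of the three outputs, hence in
      \<open>emit 0 s\<close>.\<close>
    moreover have "aval label_exp (emit 0 s) = edge_label {a j, b j}"
      using 5 by (intro aval_label_exp) auto
    ultimately show ?case
      using 5 by (intro wp_Seq wp_Emit) (auto simp: allocation_word_def)
  qed (use 5 m_le in \<open>auto simp: loaded_def solved_def allocation_word_def\<close>)
qed (use assms p_le in \<open>auto simp: loaded_def solved_def\<close>)

definition solution_word :: "nat list" where
  "solution_word = 1 # concat (map (\<lambda>i. allocation_word i m) [0..<p]) @
     concat (map (\<lambda>i. center_word i n) [0..<p])"

lemma length_solution_word: "length solution_word = 1 + 3 * (p * m) + p * n"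
  by (simp add: solution_word_def length_allocation_words length_center_words)

lemma wp_emit_centers:
  assumes "solved s" "output_word s = 1 # concat (map (\<lambda>i. allocation_word i m) [0..<p])"
    "\<And>s. output_word s = solution_word \<Longrightarrow> Q s"
  shows "wp X emit_centers Q s"
  unfolding emit_centers_def
proof (rule wp_For[where n = p and I = "\<lambda>k s. solved s \<and>
      output_word s = 1 # concat (map (\<lambda>i. allocation_word i m) [0..<p]) @
        concat (map (\<lambda>i. center_word i n) [0..<k])"], goal_cases)
  case (5 k s)
  then have k: "k < p" by simp
  show ?case
  proof (rule wp_For[where n = n and I = "\<lambda>j s. s 7 0 = k \<and> solved s \<and>
      output_word s = 1 # concat (map (\<lambda>i. allocation_word i m) [0..<p]) @
        concat (map (\<lambda>i. center_word i n) [0..<k]) @ center_word k j"], goal_cases)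
    case (5 j s)
    have "k * n + Suc j \<le> Suc k * n"
      using 5 by simp
    also have "\<dots> \<le> p * n"
      using k by (intro mult_le_mono1) simp
    finally have "length (output_word s) < 2 ^ X"
      using 5 output_le by (simp add: length_center_word length_allocation_words length_center_words)
    moreover have "aval district_center s = c (Suc k)"
      using 5 k by (intro aval_district_center) (auto simp: solved_def)
    ultimately show ?case
      using 5 by (intro wp_Emit) (auto simp: center_word_def)
  qed (use 5 n_le in \<open>auto simp: loaded_def solved_def center_word_def\<close>)
qed (use assms p_le in \<open>auto simp: loaded_def solved_def solution_word_def\<close>)

lemma wp_program:
  assumes "s 0 = inp" "\<And>k i. k \<noteq> 0 \<Longrightarrow> s k i = 0"
  shows "wp X (program contiguous) (\<lambda>s. output_word s =
    (if contiguous \<and> (\<exists>j<m. height (a j) = 0 \<and> height (b j) = 0) then [0] else solution_word)) s"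
    (is "wp X _ ?Q s")
proof -
  have emitting: "wp X (If (Times (Num (of_bool contiguous)) (var 9)) (Emit (Num 0))
      (Seq (Emit (Num 1)) (Seq emit_allocation emit_centers))) ?Q s"
    if s: "solved s" "output_word s = []"
      "s 9 0 = 0 \<longleftrightarrow> (\<forall>j<m. height (a j) \<noteq> 0 \<or> height (b j) \<noteq> 0)" for s
  proof (rule wp_If, goal_cases)
    case 1
    then show ?case
      using s by (intro wp_Emit) auto
  next
    case 2
    have "1 < (2::nat) ^ X"
      using sources p_le by (intro one_less_power) auto
    with 2 s show ?case
      by (intro wp_Seq wp_Emit wp_emit_allocation wp_emit_centers) auto
  qed
  have counting: "wp X (Seq count_unreached (If (Times (Num (of_bool contiguous)) (var 9)) (Emit (Num 0))
      (Seq (Emit (Num 1)) (Seq emit_allocation emit_centers)))) ?Q s"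
    if "solved s" "blank s" for s
    using that emitting by (intro wp_Seq wp_count_unreached)
  show ?thesis
    unfolding program_def
  proof (rule wp_Seq, rule wp_load, rule assms(1), rule wp_Seq)
    fix s'
    assume loaded: "loaded s'" and same: "\<And>k. k \<notin> {2, 3, 4} \<Longrightarrow> s' k = s k"
    from same[of 1] same[of 9] same[of 10] have "blank s'" "s' 10 = (\<lambda>_. 0)"
      using assms(2) by (auto simp: blank_def output_word_def)
    with loaded show "wp X scale_lengths (wp X (Seq compute_big (Seq init_heights
        (Seq bellman_ford (Seq count_unreached
          (If (Times (Num (of_bool contiguous)) (var 9)) (Emit (Num 0))
            (Seq (Emit (Num 1)) (Seq emit_allocation emit_centers)))))))
        ?Q) s'"
      by (rule wp_scale_lengths) (rule wp_Seq, erule (2) wp_compute_big,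
        rule wp_Seq, erule (3) wp_init_heights, rule wp_Seq, erule (3) wp_bellman_ford, erule (1) counting)
  qed
qed

end

section \<open>Encoded instances\<close>

lemma concat_concat: "concat (concat xsss) = concat (map concat xsss)"
  by (induction xsss) auto

lemma length_concat_uniform:
  "(\<And>ys. ys \<in> set yss \<Longrightarrow> length ys = k) \<Longrightarrow> length (concat yss) = k * length yss"
  by (induction yss) auto

lemma nth_concat_uniform:
  assumes "\<And>ys. ys \<in> set yss \<Longrightarrow> length ys = k" "j < length yss" "r < k"
  shows "concat yss ! (r + k * j) = yss ! j ! r"
  using assms
proof (induction yss arbitrary: j)
  case (Cons ys yss)
  then show ?case
    by (cases j) (auto simp: nth_append)
qed simp

lemma nat_size_le_word_size: "x \<in> set xs \<Longrightarrow> nat_size x \<le> word_size xs"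
  unfolding word_size_def by (intro member_le_sum_list) auto

lemma length_le_word_size: "length xs \<le> word_size xs"
  unfolding word_size_def by (induction xs) (auto simp: nat_size_def)

lemma le_power_word_size:
  assumes "x \<in> set xs"
  shows "x \<le> 2 ^ word_size xs"
proof -
  have "x \<le> 2 ^ nat_size x"
    using less_power_nat_size[of x] by simp
  also have "\<dots> \<le> 2 ^ word_size xs"
    using nat_size_le_word_size[OF assms] by (intro power_increasing) auto
  finally show ?thesis .
qed

lemma word_size_le: "(\<And>x. x \<in> set xs \<Longrightarrow> nat_size x \<le> k) \<Longrightarrow> word_size xs \<le> length xs * k"
  unfolding word_size_def by (induction xs) (auto simp: add_mono)

text \<open>For \<open>big\<close>, \<open>S * S\<close> accounts for the product of denominators
  and one \<open>S\<close> each for a numerator, the number of edges, \<open>n\<close> and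
  \<open>Suc p\<close>; the constant 3 covers the factors of 2 left over there and in the output
  length.\<close>

definition size_bound :: "nat poly" where
  "size_bound = [:3, 4, 1:]"

lemma poly_size_bound: "poly size_bound S = S * S + 4 * S + 3"
  by (simp add: size_bound_def algebra_simps)

locale encoded_districting =
  fixes X :: "constraint_group set" and I :: "nat districting" and es :: "nat set list"
    and xs :: "nat list" and n :: nat and ds :: "nat list list"
  assumes valid: "valid_instance X I"
    and given_centers: "Node_Selection \<notin> X"
    and unbalanced: "Balance \<notin> X"
    and integral: "Integrality \<in> X"
    and has_objective: "Objective \<in> X"
    and nodes_eq: "nodes I = {..<n}"
    and edges_eq: "set es = edges I"
    and codes: "list_all2 (edge_code I) es ds"
    and xs_eq: "xs = n # [0..<n] @ length es # concat ds @ districts I #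
      map (center I) [1..<Suc (districts I)]"
begin

abbreviation "m \<equiv> length es"
abbreviation "inp \<equiv> input_memory xs 0"
abbreviation "S \<equiv> word_size xs"

definition a :: "nat \<Rightarrow> nat" where "a j = ds ! j ! 0"
definition b :: "nat \<Rightarrow> nat" where "b j = ds ! j ! 1"
definition numer :: "nat \<Rightarrow> nat" where "numer j = ds ! j ! 3"
definition denom :: "nat \<Rightarrow> nat" where "denom j = ds ! j ! 4"
definition scale :: nat where "scale = (\<Prod>j<m. denom j)"
definition \<omega> :: "nat \<Rightarrow> nat" where "\<omega> j = numer j * (scale div denom j)"

text \<open>A positive weight forces sign 0 and a positive numerator, which is why the program can
  skip the sign.\<close>

lemma edge_code:
  assumes "j < m"
  shows "length (ds ! j) = 5" "es ! j = {a j, b j}" "0 < denom j" "0 < numer j"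
    "weight I {a j, b j} = real (numer j) / real (denom j)"
proof -
  have "edge_code I (es ! j) (ds ! j)"
    using codes assms by (rule list_all2_nthD)
  then obtain u v s k d where e: "es ! j = {u, v}" "ds ! j = [u, v, s, k, d]" "s \<in> {0, 1}" "0 < d"
    "weight I (es ! j) = (- 1) ^ s * real k / real d"
    unfolding edge_code_def rat_code_def by blast
  have "es ! j \<in> edges I"
    using edges_eq assms nth_mem by blast
  then have "0 < weight I (es ! j)"
    using valid by (simp add: valid_instance_def)
  then have "s = 0 \<and> 0 < k"
    using e(3-5) by (auto simp: zero_less_divide_iff)
  then show "length (ds ! j) = 5" "es ! j = {a j, b j}" "0 < denom j" "0 < numer j"
    "weight I {a j, b j} = real (numer j) / real (denom j)"
    using e by (simp_all add: a_def b_def numer_def denom_def)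
qed

lemma length_ds: "length ds = m"
  using codes by (simp add: list_all2_lengthD)

lemma length_in_ds: "ys \<in> set ds \<Longrightarrow> length ys = 5"
  using edge_code(1) length_ds by (metis in_set_conv_nth)

lemma length_concat_ds: "length (concat ds) = 5 * m"
  using length_concat_uniform[OF length_in_ds] length_ds by simp

lemma length_xs: "length xs = n + 5 * m + districts I + 3"
  by (simp add: xs_eq length_concat_ds)

lemma inp_eq: "k = Suc i \<Longrightarrow> i < length xs \<Longrightarrow> inp k = xs ! i"
  by (simp add: input_memory_def)

lemma inp_edge:
  assumes "j < m" "r < 5" "k = n + 3 + r"
  shows "inp (k + 5 * j) = ds ! j ! r"
proof -
  have less: "r + 5 * j < length (concat ds)"
    using assms length_concat_ds by simp
  have "inp (k + 5 * j) = xs ! (n + 2 + (r + 5 * j))"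
    using less assms(3) by (intro inp_eq) (simp_all add: length_xs length_concat_ds)
  also have "\<dots> = concat ds ! (r + 5 * j)"
    using less by (simp add: xs_eq nth_append)
  also have "\<dots> = ds ! j ! r"
    using assms length_ds length_in_ds by (intro nth_concat_uniform) auto
  finally show ?thesis .
qed

lemma inp_p: "inp (n + 3 + 5 * m) = districts I"
proof -
  have "inp (n + 3 + 5 * m) = xs ! (n + 2 + 5 * m)"
    by (intro inp_eq) (simp_all add: length_xs)
  then show ?thesis
    by (simp add: xs_eq nth_append length_concat_ds)
qed

lemma inp_center:
  assumes "i < districts I"
  shows "inp (n + 4 + (5 * m + i)) = center I (Suc i)"
proof -
  have "inp (n + 4 + (5 * m + i)) = xs ! (n + 3 + 5 * m + i)"
    using assms by (intro inp_eq) (simp_all add: length_xs)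
  also have "\<dots> = map (center I) [1..<Suc (districts I)] ! i"
    by (simp add: xs_eq nth_append length_concat_ds del: upt_Suc)
  finally show ?thesis
    using assms by (simp del: upt_Suc)
qed

lemma edge_mem: "j < m \<Longrightarrow> {a j, b j} \<in> edges I"
  using edge_code(2) edges_eq nth_mem by metis

lemma edges_image: "edges I = (\<lambda>j. {a j, b j}) ` {..<m}"
  using edge_code(2) unfolding edges_eq[symmetric] set_conv_nth by auto

lemma scale_pos: "0 < scale"
  unfolding scale_def using edge_code(3) by (intro prod_pos) auto

lemma denom_dvd_scale: "j < m \<Longrightarrow> denom j dvd scale"
  unfolding scale_def by (intro dvd_prodI) auto

lemma omega_pos: "j < m \<Longrightarrow> 0 < \<omega> j"
  unfolding \<omega>_def using edge_code(3,4) denom_dvd_scale scale_pos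
  by (simp add: div_greater_zero_iff dvd_imp_le)

lemma weight_eq: "j < m \<Longrightarrow> weight I {a j, b j} = real (\<omega> j) / real scale"
  using edge_code(3,5)[of j] denom_dvd_scale[of j] scale_pos
  by (simp add: \<omega>_def real_of_nat_div)

sublocale districting_voronoi n m a b \<omega> I X "real scale"
proof
  show "center I i < n" if "i \<in> {1..districts I}" for i
    using valid that given_centers nodes_eq by (auto simp: valid_instance_def)
  have "{a j, b j} \<subseteq> nodes I" if "j < m" for j
    using valid edge_mem[OF that] unfolding valid_instance_def by blast
  then show "a j < n" "b j < n" if "j < m" for j
    using that nodes_eq by auto
  show "1 \<le> districts I"
    using valid by (simp add: valid_instance_def)
qed (use valid given_centers unbalanced integral has_objective nodes_eq edges_image omega_pos
      scale_pos weight_eq in auto)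

section \<open>Size estimates\<close>

lemma field_le: "j < m \<Longrightarrow> r < 5 \<Longrightarrow> ds ! j ! r \<le> 2 ^ S"
  using edge_code(1) length_ds by (intro le_power_word_size) (auto simp: xs_eq intro!: bexI[of _ "ds ! j"])

text \<open>Vertices, five numbers per edge and one center per district are all spelled out in the
  input. Strictness for \<open>p\<close> serves the factor \<open>Suc p\<close> in
  \<open>big\<close>.\<close>

lemma counts_le: "n \<le> S" "m \<le> S" "p < S"
  using length_le_word_size[of xs] length_xs by simp_all

text \<open>At most \<open>S\<close> factors, each at most \<open>2 ^ S\<close>; this makes clearing
  denominators by their product affordable.\<close>

lemma prod_le: "k \<le> m \<Longrightarrow> (\<Prod>j<k. denom j) \<le> 2 ^ (S * S)"
proof -
  assume k: "k \<le> m"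
  then have "(\<Prod>j<k. denom j) \<le> (\<Prod>j<k. 2 ^ S)"
    using field_le by (intro prod_mono) (auto simp: denom_def)
  also have "\<dots> = 2 ^ (S * k)"
    by (simp add: power_mult)
  also have "\<dots> \<le> 2 ^ (S * S)"
    using k counts_le(2) by (intro power_increasing mult_le_mono2) auto
  finally show ?thesis .
qed

lemma big_bound: "big \<le> 2 ^ poly size_bound S"
proof -
  let ?B = "2 ^ (S * S + S) :: nat"
  have S: "x \<le> 2 ^ S" if "x \<le> S" for x :: nat
    using that less_exp[of S] by linarith
  have "\<omega> j \<le> ?B" if "j < m" for j
  proof -
    have "\<omega> j \<le> 2 ^ S * 2 ^ (S * S)"
      unfolding \<omega>_def using field_le[OF that, of 3] prod_le[of m]
      by (intro mult_le_mono) (auto simp: numer_def scale_def intro: order_trans[OF div_le_dividend])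
    then show ?thesis by (simp add: power_add mult.commute)
  qed
  then have "(\<Sum>j<m. \<omega> j) \<le> m * ?B"
    using sum_bounded_above[of "{..<m}" \<omega> ?B] by simp
  also have "\<dots> \<le> 2 ^ S * ?B"
    using S counts_le(2) by (intro mult_le_mono1)
  finally have "n * (\<Sum>j<m. \<omega> j) \<le> 2 ^ S * (2 ^ S * ?B)"
    using S counts_le(1) by (intro mult_le_mono)
  moreover have "1 \<le> 2 ^ S * (2 ^ S * ?B)"
    by simp
  ultimately have "1 + n * (\<Sum>j<m. \<omega> j) \<le> 2 * (2 ^ S * (2 ^ S * ?B))"
    by linarith
  moreover have "Suc p \<le> 2 ^ S"
    using S counts_le(3) by simp
  ultimately have "Suc p * (1 + n * (\<Sum>j<m. \<omega> j)) \<le> 2 ^ S * (2 * (2 ^ S * (2 ^ S * ?B)))"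
    by (intro mult_le_mono)
  moreover have "1 \<le> 2 ^ S * (2 * (2 ^ S * (2 ^ S * ?B)))"
    by simp
  ultimately have "big \<le> 2 * (2 ^ S * (2 * (2 ^ S * (2 ^ S * ?B))))"
    unfolding big_def by linarith
  also have "\<dots> = 2 ^ (S * S + (S + S + S + S) + 2)"
    by (simp add: power_add mult_ac)
  also have "\<dots> \<le> 2 ^ poly size_bound S"
    unfolding poly_size_bound by (intro power_increasing) auto
  finally show ?thesis .
qed

lemma output_bound: "1 + 3 * (p * m) + p * n \<le> 2 ^ poly size_bound S"
proof -
  have S: "x \<le> 2 ^ S" if "x \<le> S" for x :: nat
    using that less_exp[of S] by linarith
  have "p \<le> 2 ^ S" "m \<le> 2 ^ S" "n \<le> 2 ^ S"
    using S[of p] S[of m] S[of n] counts_le by simp_all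
  then have "p * m \<le> 2 ^ S * 2 ^ S" "p * n \<le> 2 ^ S * 2 ^ S"
    by (simp_all add: mult_le_mono)
  moreover have "1 \<le> (2::nat) ^ S * 2 ^ S"
    by simp
  ultimately have "1 + 3 * (p * m) + p * n \<le> 8 * (2 ^ S * 2 ^ S)"
    by linarith
  also have "\<dots> = 2 ^ (S + S + 3)"
    by (simp only: power_add) simp
  also have "\<dots> \<le> 2 ^ poly size_bound S"
    unfolding poly_size_bound by (intro power_increasing) auto
  finally show ?thesis .
qed

lemma inp_n: "inp 1 = n"
proof -
  have "inp 1 = xs ! 0"
    by (intro inp_eq) (simp_all add: length_xs)
  then show ?thesis by (simp add: xs_eq)
qed

lemma inp_m: "inp (n + 2) = m"
proof -
  have "inp (n + 2) = xs ! (n + 1)"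
    by (intro inp_eq) (simp_all add: length_xs)
  then show ?thesis by (simp add: xs_eq nth_append)
qed

sublocale voronoi_input n m p a b \<omega> "center I" inp numer denom "poly size_bound S"
proof
  show "inp 1 = n" "inp (n + 2) = m" "inp (n + 3 + 5 * m) = p"
    by (fact inp_n inp_m inp_p)+
  show "inp (n + 4 + (5 * m + i)) = center I (Suc i)" if "i < p" for i
    using that by (rule inp_center)
  show "inp (n + 3 + 5 * j) = a j" "inp (n + 4 + 5 * j) = b j"
    "inp (n + 6 + 5 * j) = numer j" "inp (n + 7 + 5 * j) = denom j" if "j < m" for j
    unfolding a_def b_def numer_def denom_def using that by (auto intro!: inp_edge)
  show "n \<le> poly size_bound S" "m \<le> poly size_bound S" "p \<le> poly size_bound S"
    using counts_le unfolding poly_size_bound by linarith+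
  show "(\<Prod>j<k. denom j) \<le> 2 ^ poly size_bound S" if "k \<le> m" for k
    by (rule order_trans[OF prod_le[OF that]]) (simp add: poly_size_bound)
  show "\<omega> j = numer j * ((\<Prod>k<m. denom k) div denom j)" for j
    by (simp add: \<omega>_def scale_def)
qed (fact big_bound output_bound)+

section \<open>Correctness and running time on encoded instances\<close>

lemma Max_height_edge: "Max (height ` {a j, b j}) = max (height (a j)) (height (b j))"
  by simp

text \<open>\<open>List.product\<close> varies its second component fastest, in the order of the
  nested output loops.\<close>

lemma solution_code: "solution_code I es allocation indicator_center solution_word"
  unfolding solution_code_def
proof (intro exI conjI)
  let ?qs = "map (\<lambda>(i, e). [0, of_bool (edge_label e = i), 1]) (List.product [1..<Suc p] es)"
  let ?us = "map (\<lambda>(i, v). of_bool (v = center I i)) (List.product [1..<Suc p] [0..<card (nodes I)])"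
  have "rat_code (allocation i e) [0, of_bool (edge_label e = i), 1]" for i e
    by (simp add: rat_code_def allocation_def)
  then show "list_all2 rat_code (map (\<lambda>(i, e). allocation i e) (List.product [1..<Suc p] es)) ?qs"
    by (simp add: list_all2_map1 list_all2_map2 list_all2_same split_beta)
  show "map real ?us =
      map (\<lambda>(i, v). indicator_center i v) (List.product [1..<Suc p] [0..<card (nodes I)])"
    by (simp add: indicator_center_def)
  have es: "es = map (\<lambda>j. {a j, b j}) [0..<m]"
    using edge_code(2) by (intro nth_equalityI) auto
  have "concat ?qs = concat (map (\<lambda>i. allocation_word i m) [0..<p])"
    unfolding allocation_word_def product_concat_map map_Suc_upt[symmetric] One_nat_def
    by (subst (1) es) (simp add: map_concat o_def concat_concat)
  moreover have "?us = concat (map (\<lambda>i. center_word i n) [0..<p])"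
    unfolding center_word_def product_concat_map map_Suc_upt[symmetric] One_nat_def nodes_eq
    by (simp add: map_concat o_def)
  ultimately show "solution_word = 1 # concat ?qs @ ?us"
    unfolding solution_word_def by simp
qed

text \<open>The summand \<open>[:1, 0, 4:] * [:2, 1:]\<close> pays for the output, at most
  \<open>1 + 4 * (?X * ?X)\<close> entries of size at most \<open>?X + 2\<close>; composing with
  \<open>size_bound\<close> turns a bound in \<open>?X\<close> into one in the input size.\<close>

lemma program_solves:
  "\<exists>ys t. computes (program (Contiguity \<in> X)) xs ys t \<and>
    t \<le> poly (pcompose (time_poly (program (Contiguity \<in> X)) + [:1, 0, 4:] * [:2, 1:]) size_bound) S \<and>
    solves X \<alpha> I es ys"
proof -
  let ?X = "poly size_bound S" and ?c = "program (Contiguity \<in> X)"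
  have "bounded_memory ?X (input_memory xs)"
    unfolding bounded_memory_def
  proof (intro allI)
    fix k i
    have "(length xs # xs) ! i \<le> 2 ^ S" if "i \<le> length xs"
    proof (cases i)
      case 0
      have "length xs \<le> 2 ^ S"
        using length_le_word_size[of xs] less_exp[of S] by linarith
      with 0 show ?thesis by simp
    next
      case (Suc i')
      with that show ?thesis
        using le_power_word_size[of "xs ! i'" xs] by simp
    qed
    moreover have "2 ^ S \<le> (2::nat) ^ ?X"
      unfolding poly_size_bound by (intro power_increasing) auto
    ultimately show "input_memory xs k i \<le> 2 ^ ?X"
      by (auto simp: input_memory_def intro: le_trans)
  qed
  moreover have "1 \<le> ?X"
    by (simp add: poly_size_bound)
  ultimately obtain t s where exec: "exec ?c (input_memory xs) t s" "t \<le> poly (time_poly ?c) ?X"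
    "bounded_memory ?X s" and out: "output_word s =
      (if Contiguity \<in> X \<and> (\<exists>j<m. height (a j) = 0 \<and> height (b j) = 0) then [0] else solution_word)"
    using wp_program[of "input_memory xs" "Contiguity \<in> X"] unfolding wp_def
    by (auto simp: input_memory_def)
  have "p * m \<le> ?X * ?X" "p * n \<le> ?X * ?X"
    using p_le m_le n_le by (auto intro: mult_le_mono)
  then have "length (output_word s) \<le> 1 + 4 * (?X * ?X)"
    unfolding out using length_solution_word by simp
  moreover have "nat_size x \<le> ?X + 2" if "x \<in> set (output_word s)" for x
    using that exec(3) by (intro nat_size_le) (auto simp: output_word_def bounded_memory_def)
  ultimately have "word_size (output_word s) \<le> (1 + 4 * (?X * ?X)) * (?X + 2)"
    using word_size_le mult_le_mono1 le_trans by meson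
  then have "t + word_size (output_word s) \<le>
      poly (pcompose (time_poly ?c + [:1, 0, 4:] * [:2, 1:]) size_bound) S"
    using exec(2) by (simp add: poly_pcompose algebra_simps)
  moreover have "solves X \<alpha> I es (output_word s)"
  proof (cases "Contiguity \<in> X \<and> (\<exists>j<m. height (a j) = 0 \<and> height (b j) = 0)")
    case True
    then obtain j where "j < m" "Max (height ` {a j, b j}) = 0"
      unfolding Max_height_edge by auto
    then have "\<nexists>x w. feasible X I x w"
      using True infeasible edge_mem by blast
    then show ?thesis
      using True out by (simp add: solves_def)
  next
    case False
    have "0 < Max (height ` e)" if "e \<in> edges I" "Contiguity \<in> X" for e
    proof -
      from that(1) obtain j where "j < m" "e = {a j, b j}"
        by (rule edge_cases)
      then show ?thesis
        using False that(2) by auto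
    qed
    then have "optimal X \<alpha> I allocation indicator_center"
      by (intro optimal_allocation) blast
    then show ?thesis
      using False out solution_code unfolding solves_def by auto
  qed
  ultimately show ?thesis
    using exec(1) unfolding computes_def by blast
qed

end

text \<open>Program and polynomial are chosen before the instance and depend on the constraint
  groups only through contiguity, so one argument covers both problems.\<close>

theorem poly_time_solvable_given_centers:
  assumes "Balance \<notin> X" "Node_Selection \<notin> X" "Integrality \<in> X" "Objective \<in> X"
  shows "poly_time_solvable X \<alpha>"
proof -
  have "\<exists>ys t. computes (program (Contiguity \<in> X)) xs ys t \<and>
      t \<le> poly (pcompose (time_poly (program (Contiguity \<in> X)) + [:1, 0, 4:] * [:2, 1:]) size_bound)
        (word_size xs) \<and> solves X \<alpha> I es ys"
    if I: "valid_instance X I" and code: "instance_code X I es xs" for I es xs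
  proof -
    from code obtain n ds where "nodes I = {..<n}" "set es = edges I" "list_all2 (edge_code I) es ds"
      "xs = n # [0..<n] @ length es # concat ds @ districts I # map (center I) [1..<Suc (districts I)]"
      unfolding instance_code_def using assms(1,2) by auto
    with I assms interpret encoded_districting X I es xs n ds
      by unfold_locales
    show ?thesis
      by (rule program_solves)
  qed
  then show ?thesis
    unfolding poly_time_solvable_def by blast
qed

theorem theorem2:
  fixes \<alpha> :: real
  assumes "0 \<le> \<alpha>" and "\<alpha> \<le> 1"
  shows "poly_time_solvable {Contiguity, Integrality, Objective, Weights} \<alpha> \<and>
         poly_time_solvable {Integrality, Objective, Weights} \<alpha>"
  by (intro conjI poly_time_solvable_given_centers) auto

end
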